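(* Let $M$ be a $4$-dimensional Kerr manifold, equipped with a Kerr structure. Any background metric of Kerr type $\eta=\sigma\,\check\pi^*g_o+\vartheta\vee\left(\mathsf p_o^*+\frac B2\vartheta\right)$ on $M$ has identically vanishing (Riemann) curvature.
   Context: Conventions. For $1$-forms $\alpha,\beta$: $\alpha\vee\beta=\frac12(\alpha\otimes\beta+\beta\otimes\alpha)$. For a Kähler manifold $(N,J,g_o)$ the Kähler form is $\omega_o=g_o(J\cdot,\cdot)$. Lorentzian metrics may have mostly plus or mostly minus signature. Einstein means $\mathrm{Ric}=\Lambda g$ for a constant $\Lambda$. Kerr manifold. It is a manifold $M=\mathcal S\times\mathbb R$ where $\pi:\mathcal S\to N$ is a principal $\mathbb R$-bundle over a Kähler manifold $(N,J,g_o)$, endowed with a connection $\mathcal H=\ker\theta\subset T\mathcal S$, where $\theta$ is an $\mathbb R$-invariant connection $1$-form with $d\theta=\pi^*\omega_o$ (this data is the Kerr structure). Here $\dim M=\dim_{\mathbb R}N+2$. Any connected open subset $\mathcal S\times I$, $I\subset\mathbb R$, of such a manifold is also called a Kerr manifold. Let $\pi^{\mathcal S}:M\to\mathcal S$ be the projection, $\check\pi=\pi\circ\pi^{\mathcal S}:M\to N$, $\mathsf p_o=\partial/\partial u$ the coordinate vector field of the second factor $\mathbb R$, and $\mathsf q_o$ the vector field on $M$ corresponding to the fundamental vertical vector field of $\mathcal S$ (generator of the right $\mathbb R$-action), so that $TM=\mathcal H\oplus\mathbb R\mathsf p_o\oplus\mathbb R\mathsf q_o$. Let $\vartheta=(\pi^{\mathcal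 S})^*\theta$ (so $\vartheta(\mathsf q_o)=1$, $\vartheta|_{\mathcal H+\mathbb R\mathsf p_o}=0$) and let $\mathsf p_o^*$ be the $1$-form with $\mathsf p_o^*(\mathsf p_o)=1$, $\mathsf p_o^*|_{\mathcal H+\mathbb R\mathsf q_o}=0$. Background metric of Kerr type on $M$: an Einstein Lorentzian metric of the form $\eta=\sigma\,\check\pi^*g_o+\vartheta\vee\left(\mathsf p_o^*+\frac B2\vartheta\right)$ with $B\ne0$ a constant and $\sigma$ a nowhere vanishing smooth function satisfying $\mathbf T(\sigma)=0$, where $\mathbf T=\mathsf q_o-B\mathsf p_o$. *)

theory Defs
  imports "HOL-Analysis.Analysis"
begin

section \<open>Smooth maps between open subsets of Euclidean spaces\<close>

fun Ck_on :: "nat \<Rightarrow> 'e::real_normed_vector set \<Rightarrow> ('e \<Rightarrow> 'f::real_normed_vector) \<Rightarrow> bool" where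
  "Ck_on 0 U f \<longleftrightarrow> continuous_on U f"
| "Ck_on (Suc k) U f \<longleftrightarrow> (\<forall>x\<in>U. f differentiable (at x)) \<and>
     (\<forall>v. Ck_on k U (\<lambda>x. frechet_derivative f (at x) v))"

text \<open>Only used for open sets \<open>U\<close>.\<close>

definition smooth_on :: "'e::real_normed_vector set \<Rightarrow> ('e \<Rightarrow> 'f::real_normed_vector) \<Rightarrow> bool" where
  "smooth_on U f \<longleftrightarrow> (\<forall>k. Ck_on k U f)"

section \<open>Smooth manifolds\<close>

text \<open>A chart is a pair of its domain \<open>U\<close> and the coordinate map on \<open>U\<close>; the values of the
  coordinate map outside \<open>U\<close> are irrelevant. The dimension of a manifold is the dimension of its
  model space \<open>'e\<close>.\<close>

type_synonym ('a, 'e) chart = "'a set \<times> ('a \<Rightarrow> 'e)"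

record ('a, 'e) mfd =
  mtop :: "'a topology"
  atlas :: "('a, 'e) chart set"

abbreviation points :: "('a, 'e, 'z) mfd_scheme \<Rightarrow> 'a set" where
  "points M \<equiv> topspace (mtop M)"

definition chart_inv :: "('a, 'e) chart \<Rightarrow> 'e \<Rightarrow> 'a" where
  "chart_inv c = inv_into (fst c) (snd c)"

definition chart_img :: "('a, 'e) chart \<Rightarrow> 'e set" where
  "chart_img c = snd c ` fst c"

definition smooth_manifold :: "('a, 'e::euclidean_space) mfd \<Rightarrow> bool" where
  "smooth_manifold M \<longleftrightarrow>
     Hausdorff_space (mtop M) \<and>
     (\<exists>\<B>. countable \<B> \<and> (\<forall>V\<in>\<B>. openin (mtop M) V) \<and>
        (\<forall>U x. openin (mtop M) U \<and> x \<in> U \<longrightarrow> (\<exists>V\<in>\<B>. x \<in> V \<and> V \<subseteq> U))) \<and>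
     (\<forall>c\<in>atlas M. openin (mtop M) (fst c) \<and> open (chart_img c) \<and>
        homeomorphic_map (subtopology (mtop M) (fst c)) (top_of_set (chart_img c)) (snd c)) \<and>
     (\<Union>c\<in>atlas M. fst c) = points M \<and>
     (\<forall>c\<in>atlas M. \<forall>d\<in>atlas M. smooth_on (snd c ` (fst c \<inter> fst d)) (snd d \<circ> chart_inv c))"

definition mfd_dim :: "('a, 'e::euclidean_space) mfd \<Rightarrow> nat" where
  "mfd_dim M = DIM('e)"

definition smooth_map ::
  "('a, 'e::euclidean_space) mfd \<Rightarrow> ('b, 'f::euclidean_space) mfd \<Rightarrow> ('a \<Rightarrow> 'b) \<Rightarrow> bool" where
  "smooth_map M N F \<longleftrightarrow> continuous_map (mtop M) (mtop N) F \<and>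
     (\<forall>c\<in>atlas M. \<forall>d\<in>atlas N.
        smooth_on (snd c ` (fst c \<inter> F -` fst d)) (snd d \<circ> F \<circ> chart_inv c))"

definition diffeomorphism ::
  "('a, 'e::euclidean_space) mfd \<Rightarrow> ('b, 'f::euclidean_space) mfd \<Rightarrow> ('a \<Rightarrow> 'b) \<Rightarrow> bool" where
  "diffeomorphism M N F \<longleftrightarrow> smooth_map M N F \<and>
     (\<exists>G. smooth_map N M G \<and> (\<forall>p\<in>points M. G (F p) = p) \<and> (\<forall>q\<in>points N. F (G q) = q))"

definition restrict_mfd :: "('a, 'e) mfd \<Rightarrow> 'a set \<Rightarrow> ('a, 'e) mfd" where
  "restrict_mfd M W = \<lparr>mtop = subtopology (mtop M) W, atlas = (\<lambda>c. (fst c \<inter> W, snd c)) ` atlas M\<rparr>"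

definition prod_mfd :: "('a, 'e) mfd \<Rightarrow> ('b, 'f) mfd \<Rightarrow> ('a \<times> 'b, 'e \<times> 'f) mfd" where
  "prod_mfd M N = \<lparr>mtop = prod_topology (mtop M) (mtop N),
     atlas = (\<lambda>(c, d). (fst c \<times> fst d, map_prod (snd c) (snd d))) ` (atlas M \<times> atlas N)\<rparr>"

text \<open>An open subset of the real line as a manifold.\<close>

definition line_mfd :: "real set \<Rightarrow> (real, real) mfd" where
  "line_mfd I = \<lparr>mtop = top_of_set I, atlas = {(I, id)}\<rparr>"

definition smooth_near :: "('a, 'e::euclidean_space) mfd \<Rightarrow> 'a \<Rightarrow> ('a \<Rightarrow> real) \<Rightarrow> bool" where
  "smooth_near M p f \<longleftrightarrow> (\<exists>W. openin (mtop M) W \<and> p \<in> W \<and>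
     (\<forall>c\<in>atlas M. smooth_on (snd c ` (fst c \<inter> W)) (f \<circ> chart_inv c)))"

definition smooth_fun :: "('a, 'e::euclidean_space) mfd \<Rightarrow> ('a \<Rightarrow> real) \<Rightarrow> bool" where
  "smooth_fun M f \<longleftrightarrow> (\<forall>c\<in>atlas M. smooth_on (chart_img c) (f \<circ> chart_inv c))"

section \<open>Tangent vectors\<close>

text \<open>A tangent vector at \<open>p\<close> is represented by the derivation it induces on functions smooth near
  \<open>p\<close>, extended by \<open>0\<close> to all other functions so that equality of tangent vectors is equality in
  HOL. \<open>coord_vec M c p u\<close> is the vector at \<open>p\<close> with component vector \<open>u\<close> in the chart \<open>c\<close>, and
  \<open>chart_diff c\<close> (the differential of the coordinate map) reads off the components.\<close>

type_synonym 'a tvec = "('a \<Rightarrow> real) \<Rightarrow> real"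

definition coord_vec ::
  "('a, 'e::euclidean_space) mfd \<Rightarrow> ('a, 'e) chart \<Rightarrow> 'a \<Rightarrow> 'e \<Rightarrow> 'a tvec" where
  "coord_vec M c p u = (\<lambda>f. if smooth_near M p f
     then frechet_derivative (f \<circ> chart_inv c) (at (snd c p)) u else 0)"

definition tangent_space :: "('a, 'e::euclidean_space) mfd \<Rightarrow> 'a \<Rightarrow> 'a tvec set" where
  "tangent_space M p = {coord_vec M c p u | c u. c \<in> atlas M \<and> p \<in> fst c}"

definition chart_diff :: "('a, 'e::euclidean_space) chart \<Rightarrow> 'a tvec \<Rightarrow> 'e" where
  "chart_diff c v = (\<Sum>i\<in>Basis. v (\<lambda>q. snd c q \<bullet> i) *\<^sub>R i)"

text \<open>The differential \<open>T\<^sub>p M \<rightarrow> T\<^bsub>F p\<^esub> N\<close> of a smooth map \<open>F\<close>.\<close>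

definition differential ::
  "('b, 'f::euclidean_space) mfd \<Rightarrow> ('a \<Rightarrow> 'b) \<Rightarrow> 'a \<Rightarrow> 'a tvec \<Rightarrow> 'b tvec" where
  "differential N F p v = (\<lambda>f. if smooth_near N (F p) f then v (f \<circ> F) else 0)"

definition velocity :: "('a, 'e::euclidean_space) mfd \<Rightarrow> (real \<Rightarrow> 'a) \<Rightarrow> real \<Rightarrow> 'a tvec" where
  "velocity M \<gamma> t = (\<lambda>f. if smooth_near M (\<gamma> t) f then deriv (f \<circ> \<gamma>) t else 0)"

section \<open>Tensor fields\<close>

text \<open>Covariant tensor fields are functions of a point and of tangent vectors at this point; their
  values on other arguments are irrelevant. Their components in a chart are functions on the
  chart image.\<close>

definition comp1 :: "('a, 'e::euclidean_space) mfd \<Rightarrow> ('a, 'e) chart \<Rightarrow> ('a \<Rightarrow> 'a tvec \<Rightarrow> real)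
    \<Rightarrow> 'e \<Rightarrow> 'e \<Rightarrow> real" where
  "comp1 M c \<alpha> x u = (let p = chart_inv c x in \<alpha> p (coord_vec M c p u))"

definition comp2 :: "('a, 'e::euclidean_space) mfd \<Rightarrow> ('a, 'e) chart
    \<Rightarrow> ('a \<Rightarrow> 'a tvec \<Rightarrow> 'a tvec \<Rightarrow> real) \<Rightarrow> 'e \<Rightarrow> 'e \<Rightarrow> 'e \<Rightarrow> real" where
  "comp2 M c b x u v = (let p = chart_inv c x in b p (coord_vec M c p u) (coord_vec M c p v))"

definition comp_endo :: "('a, 'e::euclidean_space) mfd \<Rightarrow> ('a, 'e) chart
    \<Rightarrow> ('a \<Rightarrow> 'a tvec \<Rightarrow> 'a tvec) \<Rightarrow> 'e \<Rightarrow> 'e \<Rightarrow> 'e" where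
  "comp_endo M c J x u = (let p = chart_inv c x in chart_diff c (J p (coord_vec M c p u)))"

definition one_form :: "('a, 'e::euclidean_space) mfd \<Rightarrow> ('a \<Rightarrow> 'a tvec \<Rightarrow> real) \<Rightarrow> bool" where
  "one_form M \<alpha> \<longleftrightarrow> (\<forall>c\<in>atlas M.
     (\<forall>x\<in>chart_img c. linear (comp1 M c \<alpha> x)) \<and>
     (\<forall>u. smooth_on (chart_img c) (\<lambda>x. comp1 M c \<alpha> x u)))"

definition sym_tensor :: "('a, 'e::euclidean_space) mfd \<Rightarrow> ('a \<Rightarrow> 'a tvec \<Rightarrow> 'a tvec \<Rightarrow> real) \<Rightarrow> bool"
  where
  "sym_tensor M g \<longleftrightarrow> (\<forall>c\<in>atlas M.
     (\<forall>x\<in>chart_img c. bilinear (comp2 M c g x) \<and> (\<forall>u v. comp2 M c g x u v = comp2 M c g x v u)) \<and>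
     (\<forall>u v. smooth_on (chart_img c) (\<lambda>x. comp2 M c g x u v)))"

definition endo_field :: "('a, 'e::euclidean_space) mfd \<Rightarrow> ('a \<Rightarrow> 'a tvec \<Rightarrow> 'a tvec) \<Rightarrow> bool" where
  "endo_field M J \<longleftrightarrow> (\<forall>p\<in>points M. J p ` tangent_space M p \<subseteq> tangent_space M p) \<and>
     (\<forall>c\<in>atlas M. (\<forall>x\<in>chart_img c. linear (comp_endo M c J x)) \<and>
       (\<forall>u. smooth_on (chart_img c) (\<lambda>x. comp_endo M c J x u)))"

text \<open>Components in a chart of the exterior derivatives of a \<open>1\<close>-form and of a \<open>2\<close>-form, with the
  convention \<open>d\<alpha>(X,Y) = X(\<alpha>(Y)) - Y(\<alpha>(X)) - \<alpha>([X,Y])\<close>.\<close>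

definition ext_deriv1 :: "('e::euclidean_space \<Rightarrow> 'e \<Rightarrow> real) \<Rightarrow> 'e \<Rightarrow> 'e \<Rightarrow> 'e \<Rightarrow> real" where
  "ext_deriv1 a x u v =
     frechet_derivative (\<lambda>y. a y v) (at x) u - frechet_derivative (\<lambda>y. a y u) (at x) v"

definition ext_deriv2 :: "('e::euclidean_space \<Rightarrow> 'e \<Rightarrow> 'e \<Rightarrow> real) \<Rightarrow> 'e \<Rightarrow> 'e \<Rightarrow> 'e \<Rightarrow> 'e \<Rightarrow> real"
  where
  "ext_deriv2 b x u v w = frechet_derivative (\<lambda>y. b y v w) (at x) u +
     frechet_derivative (\<lambda>y. b y w u) (at x) v + frechet_derivative (\<lambda>y. b y u v) (at x) w"

section \<open>Metrics and curvature\<close>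

definition riemannian_metric ::
  "('a, 'e::euclidean_space) mfd \<Rightarrow> ('a \<Rightarrow> 'a tvec \<Rightarrow> 'a tvec \<Rightarrow> real) \<Rightarrow> bool" where
  "riemannian_metric M g \<longleftrightarrow> sym_tensor M g \<and>
     (\<forall>p\<in>points M. \<forall>v\<in>tangent_space M p. v \<noteq> (\<lambda>f. 0) \<longrightarrow> g p v v > 0)"

text \<open>Signature \<open>(-,+,\<dots>,+)\<close> for \<open>\<epsilon> = 1\<close> and \<open>(+,-,\<dots>,-)\<close> for \<open>\<epsilon> = -1\<close>.\<close>

definition lorentzian_metric ::
  "('a, 'e::euclidean_space) mfd \<Rightarrow> ('a \<Rightarrow> 'a tvec \<Rightarrow> 'a tvec \<Rightarrow> real) \<Rightarrow> bool" where
  "lorentzian_metric M g \<longleftrightarrow> sym_tensor M g \<and>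
     (\<exists>\<epsilon>\<in>{1, -1}. \<forall>p\<in>points M. \<exists>b::'e \<Rightarrow> 'a tvec. \<exists>k\<in>Basis. b ` Basis \<subseteq> tangent_space M p \<and>
        (\<forall>i\<in>Basis. \<forall>j\<in>Basis.
           g p (b i) (b j) = (if i \<noteq> j then 0 else if i = k then - \<epsilon> else \<epsilon>)))"

text \<open>The following are the local expressions of the Levi-Civita connection, determined by the
  Koszul formula \<open>2 h(\<Gamma>(u,v),w) = \<partial>\<^sub>u h(v,w) + \<partial>\<^sub>v h(u,w) - \<partial>\<^sub>w h(u,v)\<close> for constant vector fields
  \<open>u, v, w\<close>, of the Riemann tensor \<open>R(u,v)w = \<nabla>\<^sub>u\<nabla>\<^sub>v w - \<nabla>\<^sub>v\<nabla>\<^sub>u w\<close>, and of the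
  Ricci tensor \<open>Ric(v,w) = tr (u \<mapsto> R(u,v)w)\<close>, for a nondegenerate metric \<open>h\<close> on an open subset of
  the model space.\<close>

definition christoffel ::
  "('e::euclidean_space \<Rightarrow> 'e \<Rightarrow> 'e \<Rightarrow> real) \<Rightarrow> 'e \<Rightarrow> 'e \<Rightarrow> 'e \<Rightarrow> 'e" where
  "christoffel h x u v = (THE z. \<forall>w. 2 * h x z w =
     frechet_derivative (\<lambda>y. h y v w) (at x) u + frechet_derivative (\<lambda>y. h y u w) (at x) v
     - frechet_derivative (\<lambda>y. h y u v) (at x) w)"

definition riemann ::
  "('e::euclidean_space \<Rightarrow> 'e \<Rightarrow> 'e \<Rightarrow> real) \<Rightarrow> 'e \<Rightarrow> 'e \<Rightarrow> 'e \<Rightarrow> 'e \<Rightarrow> 'e" where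
  "riemann h x u v w =
     frechet_derivative (\<lambda>y. christoffel h y v w) (at x) u
     - frechet_derivative (\<lambda>y. christoffel h y u w) (at x) v
     + christoffel h x u (christoffel h x v w) - christoffel h x v (christoffel h x u w)"

definition ricci :: "('e::euclidean_space \<Rightarrow> 'e \<Rightarrow> 'e \<Rightarrow> real) \<Rightarrow> 'e \<Rightarrow> 'e \<Rightarrow> 'e \<Rightarrow> real" where
  "ricci h x v w = (\<Sum>i\<in>Basis. riemann h x i v w \<bullet> i)"

definition einstein ::
  "('a, 'e::euclidean_space) mfd \<Rightarrow> ('a \<Rightarrow> 'a tvec \<Rightarrow> 'a tvec \<Rightarrow> real) \<Rightarrow> bool" where
  "einstein M g \<longleftrightarrow> (\<exists>\<Lambda>. \<forall>c\<in>atlas M. \<forall>x\<in>chart_img c. \<forall>v w.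
     ricci (comp2 M c g) x v w = \<Lambda> * comp2 M c g x v w)"

definition vanishing_curvature ::
  "('a, 'e::euclidean_space) mfd \<Rightarrow> ('a \<Rightarrow> 'a tvec \<Rightarrow> 'a tvec \<Rightarrow> real) \<Rightarrow> bool" where
  "vanishing_curvature M g \<longleftrightarrow> (\<forall>c\<in>atlas M. \<forall>x\<in>chart_img c. \<forall>u v w.
     riemann (comp2 M c g) x u v w = 0)"

section \<open>Kaehler manifolds\<close>

text \<open>A complex structure is an endomorphism field with square \<open>-1\<close> that is given by a constant
  linear map in suitable smooth charts (holomorphic coordinates) around every point.\<close>

definition complex_structure ::
  "('a, 'e::euclidean_space) mfd \<Rightarrow> ('a \<Rightarrow> 'a tvec \<Rightarrow> 'a tvec) \<Rightarrow> bool" where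
  "complex_structure M J \<longleftrightarrow> endo_field M J \<and>
     (\<forall>p\<in>points M. \<forall>v\<in>tangent_space M p. J p (J p v) = (\<lambda>f. - v f)) \<and>
     (\<forall>p\<in>points M. \<exists>c J0. p \<in> fst c \<and> smooth_manifold (M\<lparr>atlas := insert c (atlas M)\<rparr>) \<and> linear J0 \<and>
        (\<forall>q\<in>fst c. \<forall>v\<in>tangent_space M q. chart_diff c (J q v) = J0 (chart_diff c v)))"

definition kaehler_form :: "('a \<Rightarrow> 'a tvec \<Rightarrow> 'a tvec) \<Rightarrow> ('a \<Rightarrow> 'a tvec \<Rightarrow> 'a tvec \<Rightarrow> real)
    \<Rightarrow> 'a \<Rightarrow> 'a tvec \<Rightarrow> 'a tvec \<Rightarrow> real" where
  "kaehler_form J g p v w = g p (J p v) w"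

definition kaehler_manifold :: "('a, 'e::euclidean_space) mfd \<Rightarrow> ('a \<Rightarrow> 'a tvec \<Rightarrow> 'a tvec)
    \<Rightarrow> ('a \<Rightarrow> 'a tvec \<Rightarrow> 'a tvec \<Rightarrow> real) \<Rightarrow> bool" where
  "kaehler_manifold N J g \<longleftrightarrow> smooth_manifold N \<and> complex_structure N J \<and> riemannian_metric N g \<and>
     (\<forall>p\<in>points N. \<forall>v\<in>tangent_space N p. \<forall>w\<in>tangent_space N p. g p (J p v) (J p w) = g p v w) \<and>
     (\<forall>c\<in>atlas N. \<forall>x\<in>chart_img c. \<forall>u v w. ext_deriv2 (comp2 N c (kaehler_form J g)) x u v w = 0)"

section \<open>Kerr manifolds\<close>

text \<open>Principal bundles with the additive group of reals as structure group; \<open>act s t\<close> is the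
  right action of \<open>t\<close> on \<open>s\<close>.\<close>

definition principal_line_bundle :: "('n, 'en::euclidean_space) mfd \<Rightarrow> ('s, 'es::euclidean_space) mfd
    \<Rightarrow> ('s \<Rightarrow> real \<Rightarrow> 's) \<Rightarrow> ('s \<Rightarrow> 'n) \<Rightarrow> bool" where
  "principal_line_bundle N S act \<pi> \<longleftrightarrow>
     smooth_manifold N \<and> smooth_manifold S \<and> smooth_map S N \<pi> \<and>
     smooth_map (prod_mfd S (line_mfd UNIV)) S (\<lambda>(s, t). act s t) \<and>
     (\<forall>s\<in>points S. act s 0 = s \<and> (\<forall>t t'. act (act s t) t' = act s (t + t'))) \<and>
     (\<forall>x\<in>points N. \<exists>U \<Phi>. openin (mtop N) U \<and> x \<in> U \<and>
        diffeomorphism (restrict_mfd S (points S \<inter> \<pi> -` U))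
          (prod_mfd (restrict_mfd N U) (line_mfd UNIV)) \<Phi> \<and>
        (\<forall>s\<in>points S \<inter> \<pi> -` U. fst (\<Phi> s) = \<pi> s \<and>
           (\<forall>t. \<Phi> (act s t) = (fst (\<Phi> s), snd (\<Phi> s) + t))))"

definition connection_form :: "('s, 'es::euclidean_space) mfd \<Rightarrow> ('s \<Rightarrow> real \<Rightarrow> 's)
    \<Rightarrow> ('s \<Rightarrow> 's tvec \<Rightarrow> real) \<Rightarrow> bool" where
  "connection_form S act \<theta> \<longleftrightarrow> one_form S \<theta> \<and>
     (\<forall>s\<in>points S. \<theta> s (velocity S (act s) 0) = 1) \<and>
     (\<forall>s\<in>points S. \<forall>t. \<forall>v\<in>tangent_space S s.
        \<theta> (act s t) (differential S (\<lambda>s'. act s' t) s v) = \<theta> s v)"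

text \<open>The last condition is \<open>d\<theta> = \<pi>\<^sup>* \<omega>\<close> for the Kaehler form \<open>\<omega>\<close>.\<close>

definition kerr_structure :: "('n, 'en::euclidean_space) mfd \<Rightarrow> ('n \<Rightarrow> 'n tvec \<Rightarrow> 'n tvec)
    \<Rightarrow> ('n \<Rightarrow> 'n tvec \<Rightarrow> 'n tvec \<Rightarrow> real) \<Rightarrow> ('s, 'es::euclidean_space) mfd
    \<Rightarrow> ('s \<Rightarrow> real \<Rightarrow> 's) \<Rightarrow> ('s \<Rightarrow> 'n) \<Rightarrow> ('s \<Rightarrow> 's tvec \<Rightarrow> real) \<Rightarrow> bool" where
  "kerr_structure N J g S act \<pi> \<theta> \<longleftrightarrow>
     kaehler_manifold N J g \<and> principal_line_bundle N S act \<pi> \<and> connection_form S act \<theta> \<and>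
     (\<forall>c\<in>atlas S. \<forall>x\<in>chart_img c. \<forall>u v. ext_deriv1 (comp1 S c \<theta>) x u v =
        comp2 S c (\<lambda>s v w. kaehler_form J g (\<pi> s) (differential N \<pi> s v) (differential N \<pi> s w)) x u v)"

definition kerr_mfd :: "('s, 'es) mfd \<Rightarrow> real set \<Rightarrow> ('s \<times> real, 'es \<times> real) mfd" where
  "kerr_mfd S I = prod_mfd S (line_mfd I)"

definition kerr_domain :: "('s, 'es) mfd \<Rightarrow> real set \<Rightarrow> bool" where
  "kerr_domain S I \<longleftrightarrow> I = UNIV \<or> (open I \<and> connected_space (mtop (kerr_mfd S I)))"

definition p_field :: "('s, 'es::euclidean_space) mfd \<Rightarrow> real set \<Rightarrow> 's \<times> real \<Rightarrow> ('s \<times> real) tvec"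
  where
  "p_field S I = (\<lambda>(s, u). velocity (kerr_mfd S I) (\<lambda>t. (s, t)) u)"

definition q_field :: "('s, 'es::euclidean_space) mfd \<Rightarrow> ('s \<Rightarrow> real \<Rightarrow> 's) \<Rightarrow> real set
    \<Rightarrow> 's \<times> real \<Rightarrow> ('s \<times> real) tvec" where
  "q_field S act I = (\<lambda>(s, u). velocity (kerr_mfd S I) (\<lambda>t. (act s t, u)) 0)"

definition lifted_form :: "('s, 'es::euclidean_space) mfd \<Rightarrow> ('s \<Rightarrow> 's tvec \<Rightarrow> real)
    \<Rightarrow> 's \<times> real \<Rightarrow> ('s \<times> real) tvec \<Rightarrow> real" where
  "lifted_form S \<theta> p v = \<theta> (fst p) (differential S fst p v)"

text \<open>\<open>\<beta>\<close> is the \<open>1\<close>-form with value \<open>1\<close> on the coordinate field of the second factor that vanishes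
  on the fundamental field and on the horizontal space. The latter is the kernel of \<open>\<theta>\<close>, regarded
  as a subspace of the tangent space of \<open>S \<times> I\<close> via the slice inclusions.\<close>

definition is_p_dual :: "('s, 'es::euclidean_space) mfd \<Rightarrow> ('s \<Rightarrow> real \<Rightarrow> 's)
    \<Rightarrow> ('s \<Rightarrow> 's tvec \<Rightarrow> real) \<Rightarrow> real set \<Rightarrow> ('s \<times> real \<Rightarrow> ('s \<times> real) tvec \<Rightarrow> real) \<Rightarrow> bool" where
  "is_p_dual S act \<theta> I \<beta> \<longleftrightarrow> one_form (kerr_mfd S I) \<beta> \<and>
     (\<forall>s\<in>points S. \<forall>u\<in>I.
        \<beta> (s, u) (p_field S I (s, u)) = 1 \<and> \<beta> (s, u) (q_field S act I (s, u)) = 0 \<and>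
        (\<forall>w\<in>tangent_space S s. \<theta> s w = 0 \<longrightarrow>
           \<beta> (s, u) (differential (kerr_mfd S I) (\<lambda>s'. (s', u)) s w) = 0))"

definition sym_prod :: "('v \<Rightarrow> real) \<Rightarrow> ('v \<Rightarrow> real) \<Rightarrow> 'v \<Rightarrow> 'v \<Rightarrow> real" where
  "sym_prod \<alpha> \<beta> v w = (\<alpha> v * \<beta> w + \<beta> v * \<alpha> w) / 2"

definition kerr_background_metric :: "('n, 'en::euclidean_space) mfd
    \<Rightarrow> ('n \<Rightarrow> 'n tvec \<Rightarrow> 'n tvec \<Rightarrow> real) \<Rightarrow> ('s, 'es::euclidean_space) mfd
    \<Rightarrow> ('s \<Rightarrow> real \<Rightarrow> 's) \<Rightarrow> ('s \<Rightarrow> 'n) \<Rightarrow> ('s \<Rightarrow> 's tvec \<Rightarrow> real) \<Rightarrow> real set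
    \<Rightarrow> ('s \<times> real \<Rightarrow> real) \<Rightarrow> real
    \<Rightarrow> ('s \<times> real \<Rightarrow> ('s \<times> real) tvec \<Rightarrow> ('s \<times> real) tvec \<Rightarrow> real) \<Rightarrow> bool" where
  "kerr_background_metric N g S act \<pi> \<theta> I \<sigma> B \<eta> \<longleftrightarrow>
     (let M = kerr_mfd S I; pr = \<pi> \<circ> fst; \<nu> = lifted_form S \<theta> in
     B \<noteq> 0 \<and> smooth_fun M \<sigma> \<and> (\<forall>p\<in>points M. \<sigma> p \<noteq> 0) \<and>
     (\<forall>p\<in>points M. q_field S act I p \<sigma> - B * p_field S I p \<sigma> = 0) \<and>
     (\<exists>\<beta>. is_p_dual S act \<theta> I \<beta> \<and>
       (\<forall>p\<in>points M. \<forall>v\<in>tangent_space M p. \<forall>w\<in>tangent_space M p.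
          \<eta> p v w = \<sigma> p * g (pr p) (differential N pr p v) (differential N pr p w)
            + sym_prod (\<nu> p) (\<lambda>z. \<beta> p z + B / 2 * \<nu> p z) v w)) \<and>
     lorentzian_metric M \<eta> \<and> einstein M \<eta>)"

end

theory Submission
  imports Defs
begin

text \<open>Let \<open>u\<close> be the coordinate of the second factor, so that \<open>p\<^sup>* = du\<close>, and \<open>T = q - B p\<close> the field along
  which \<open>\<sigma>\<close> is constant. Completing the square gives
  \<open>\<eta> = (\<sigma> g + (B / 2) (\<vartheta> + du / B)\<^sup>2) - du\<^sup>2 / (2 B)\<close>, and the first summand is annihilated by \<open>T\<close> and
  invariant under its flow: the metric is locally a product of a three-dimensional metric and a line
  spanned by \<open>T\<close>. A product with a line has \<open>Ric(T, T) = 0\<close>, so the Einstein constant vanishes, the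
  three-dimensional factor is Ricci flat, and in dimension three this forces the curvature to vanish.

  The proof does not construct the product coordinates. It shows in an arbitrary chart that \<open>T\<close> is
  parallel, because its metric dual \<open>\<eta>(T, \<cdot>) = du / 2\<close> has constant components, hence is closed, and
  because \<open>T\<close> is a Killing field. The Killing equation splits into three parts. First, \<open>\<sigma>\<close> is
  constant along \<open>T\<close>. Second, the fundamental field \<open>Z\<close> of the action preserves \<open>\<theta>\<close>: as \<open>\<theta>(Z) = 1\<close>
  and \<open>d\<theta>\<close> is pulled back from the base, \<open>d\<theta>(Z, \<cdot>) = 0\<close> (\<open>th_lie\<close>). Third, \<open>Z\<close> preserves the
  pullback of the base metric, because \<open>Z\<close> is annihilated by the differential of the projection
  (\<open>G_lie\<close>). A parallel field satisfies \<open>R(u, v) T = 0\<close> (\<open>riemann_parallel_field\<close>), and the rest is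
  algebra of curvature tensors at a single point (\<open>flat_if_einstein_with_parallel_vector\<close>), which is
  done in a frame that is orthogonal for \<open>\<eta>\<close> and contains \<open>T\<close>.

  Two analytic facts are needed along the way. Second derivatives of smooth maps are symmetric, which
  enters the skew-symmetry of the curvature with respect to the metric, the vanishing of \<open>R(u, v) T\<close>
  and the invariance of the pulled back metric. The Christoffel symbols, which are given only as
  solutions of the Koszul equations, are differentiable (\<open>differentiable_solution\<close>).\<close>

section \<open>Smooth maps\<close>

abbreviation fd :: "('e::real_normed_vector \<Rightarrow> 'f::real_normed_vector) \<Rightarrow> 'e \<Rightarrow> 'e \<Rightarrow> 'f" where
  "fd f x \<equiv> frechet_derivative f (at x)"

lemma fd_eq: "(f has_derivative f') (at x) \<Longrightarrow> fd f x = f'"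
  using frechet_derivative_at by metis

lemma has_derivative_fd: "f differentiable (at x) \<Longrightarrow> (f has_derivative fd f x) (at x)"
  using frechet_derivative_works by blast

lemma linear_fd: "f differentiable (at x) \<Longrightarrow> linear (fd f x)"
  by (rule linear_frechet_derivative)

lemma differentiable_eq_open:
  assumes "open U" "x \<in> U" "\<And>y. y \<in> U \<Longrightarrow> f y = g y" "f differentiable (at x)"
  shows "g differentiable (at x)"
  using assms has_derivative_transform_within_open unfolding differentiable_def by blast

lemma fd_eq_open:
  assumes "open U" "x \<in> U" "\<And>y. y \<in> U \<Longrightarrow> f y = g y"
  shows "fd f x = fd g x"
  unfolding frechet_derivative_def
  using has_derivative_transform_within_open[of f _ x UNIV U g]
    has_derivative_transform_within_open[of g _ x UNIV U f] assms
  by (metis (full_types))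

lemma Ck_on_subset: "Ck_on k U f \<Longrightarrow> V \<subseteq> U \<Longrightarrow> Ck_on k V f"
  by (induction k arbitrary: f) (auto intro: continuous_on_subset)

lemma Ck_on_cong:
  "Ck_on k U f \<Longrightarrow> open U \<Longrightarrow> (\<And>x. x \<in> U \<Longrightarrow> f x = g x) \<Longrightarrow> Ck_on k U g"
proof (induction k arbitrary: f g)
  case 0
  then show ?case by (simp cong: continuous_on_cong)
next
  case (Suc k)
  have "g differentiable (at x)" if "x \<in> U" for x
    using Suc.prems that differentiable_eq_open by (metis Ck_on.simps(2))
  moreover have "Ck_on k U (\<lambda>x. fd g x v)" for v
  proof (rule Suc.IH)
    show "Ck_on k U (\<lambda>x. fd f x v)" using Suc.prems by simp
    show "fd f x v = fd g x v" if "x \<in> U" for x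
      using fd_eq_open[OF Suc.prems(2) that] Suc.prems(3) by metis
  qed (rule Suc.prems)
  ultimately show ?case by simp
qed

lemma Ck_on_Suc_imp: "Ck_on (Suc k) U f \<Longrightarrow> Ck_on k U f"
proof (induction k arbitrary: f)
  case 0
  then show ?case
    by (simp add: continuous_at_imp_continuous_on differentiable_imp_continuous_within)
next
  case (Suc k)
  have "Ck_on k U (\<lambda>x. fd f x v)" for v
    by (rule Suc.IH) (use Suc.prems Ck_on.simps(2) in metis)
  then show ?case using Suc.prems by simp
qed

lemma Ck_on_const: "Ck_on k U (\<lambda>x. c)"
  by (induction k arbitrary: c) simp_all

lemma Ck_on_add:
  "Ck_on k U f \<Longrightarrow> Ck_on k U g \<Longrightarrow> open U \<Longrightarrow> Ck_on k U (\<lambda>x. f x + g x)"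
proof (induction k arbitrary: f g)
  case 0
  then show ?case by (simp add: continuous_on_add)
next
  case (Suc k)
  have "Ck_on k U (\<lambda>x. fd (\<lambda>x. f x + g x) x v)" for v
  proof (rule Ck_on_cong)
    show "Ck_on k U (\<lambda>x. fd f x v + fd g x v)" using Suc by simp
    fix x assume "x \<in> U"
    then have "((\<lambda>x. f x + g x) has_derivative (\<lambda>v. fd f x v + fd g x v)) (at x)"
      using Suc.prems by (intro has_derivative_add has_derivative_fd) auto
    then show "fd f x v + fd g x v = fd (\<lambda>x. f x + g x) x v" by (simp add: fd_eq)
  qed (rule Suc.prems)
  then show ?case using Suc.prems by simp
qed

lemma Ck_on_scaleR:
  "Ck_on k U f \<Longrightarrow> Ck_on k U g \<Longrightarrow> open U \<Longrightarrow> Ck_on k U (\<lambda>x. f x *\<^sub>R g x)"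
proof (induction k arbitrary: f g)
  case 0
  then show ?case by (simp add: continuous_on_scaleR)
next
  case (Suc k)
  have d: "((\<lambda>x. f x *\<^sub>R g x) has_derivative (\<lambda>v. f x *\<^sub>R fd g x v + fd f x v *\<^sub>R g x)) (at x)"
    if "x \<in> U" for x
    using Suc.prems that by (intro has_derivative_scaleR has_derivative_fd) auto
  have "Ck_on k U (\<lambda>x. fd (\<lambda>x. f x *\<^sub>R g x) x v)" for v
  proof (rule Ck_on_cong)
    show "Ck_on k U (\<lambda>x. f x *\<^sub>R fd g x v + fd f x v *\<^sub>R g x)"
      using Suc.prems Ck_on_Suc_imp[OF Suc.prems(1)] Ck_on_Suc_imp[OF Suc.prems(2)]
      by (intro Ck_on_add Suc.IH) auto
    show "f x *\<^sub>R fd g x v + fd f x v *\<^sub>R g x = fd (\<lambda>x. f x *\<^sub>R g x) x v" if "x \<in> U" for x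
      using fd_eq[OF d[OF that]] by simp
  qed (rule Suc.prems)
  then show ?case using d by (auto simp: differentiable_def)
qed

lemma Ck_on_sum:
  assumes "finite A" "\<And>i. i \<in> A \<Longrightarrow> Ck_on k U (f i)" "open U"
  shows "Ck_on k U (\<lambda>x. \<Sum>i\<in>A. f i x)"
  using assms by (induction rule: finite_induct) (auto intro: Ck_on_const Ck_on_add)

lemma Ck_on_linear:
  "Ck_on k U f \<Longrightarrow> bounded_linear L \<Longrightarrow> open U \<Longrightarrow> Ck_on k U (\<lambda>x. L (f x))"
proof (induction k arbitrary: f)
  case 0
  then show ?case by (simp add: linear_continuous_on_compose bounded_linear.continuous_on)
next
  case (Suc k)
  have d: "((\<lambda>x. L (f x)) has_derivative (\<lambda>v. L (fd f x v))) (at x)" if "x \<in> U" for x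
    using Suc.prems that
    by (intro bounded_linear.has_derivative[OF Suc.prems(2)] has_derivative_fd) auto
  have "Ck_on k U (\<lambda>x. fd (\<lambda>x. L (f x)) x v)" for v
  proof (rule Ck_on_cong)
    show "Ck_on k U (\<lambda>x. L (fd f x v))" using Suc by auto
    show "L (fd f x v) = fd (\<lambda>x. L (f x)) x v" if "x \<in> U" for x
      using fd_eq[OF d[OF that]] by simp
  qed (rule Suc.prems)
  then show ?case using d by (auto simp: differentiable_def)
qed

text \<open>Expanding the inner derivative in a basis turns the chain rule into a sum of products of a
  component of the derivative of \<open>f\<close> and a partial derivative of \<open>g\<close> composed with \<open>f\<close>; both factors
  are one order less smooth, so the induction closes. The basis is the reason for the sort
  constraint on the type between the two maps.\<close>

lemma Ck_on_compose:
  fixes f :: "'a::real_normed_vector \<Rightarrow> 'b::euclidean_space"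
  shows "Ck_on k V g \<Longrightarrow> Ck_on k U f \<Longrightarrow> open U \<Longrightarrow> f ` U \<subseteq> V \<Longrightarrow> Ck_on k U (\<lambda>x. g (f x))"
proof (induction k arbitrary: g)
  case 0
  then show ?case by (auto intro: continuous_on_compose2)
next
  case (Suc k)
  have dg: "g differentiable (at (f x))" if "x \<in> U" for x using Suc.prems that by auto
  have d: "((\<lambda>x. g (f x)) has_derivative (\<lambda>v. fd g (f x) (fd f x v))) (at x)" if "x \<in> U" for x
    using Suc.prems that dg[OF that] by (intro has_derivative_compose[of f _ x UNIV g] has_derivative_fd) auto
  have "Ck_on k U (\<lambda>x. fd (\<lambda>x. g (f x)) x v)" for v
  proof (rule Ck_on_cong)
    show "Ck_on k U (\<lambda>x. \<Sum>i\<in>Basis. (fd f x v \<bullet> i) *\<^sub>R fd g (f x) i)"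
    proof (intro Ck_on_sum Ck_on_scaleR)
      fix i :: 'b
      show "Ck_on k U (\<lambda>x. fd f x v \<bullet> i)"
        using Suc.prems by (intro Ck_on_linear[where L="\<lambda>x. x \<bullet> i"] bounded_linear_inner_left) auto
      show "Ck_on k U (\<lambda>x. fd g (f x) i)"
        by (rule Suc.IH) (use Suc.prems Ck_on_Suc_imp[OF Suc.prems(2)] in auto)
    qed (use Suc.prems in auto)
    show "(\<Sum>i\<in>Basis. (fd f x v \<bullet> i) *\<^sub>R fd g (f x) i) = fd (\<lambda>x. g (f x)) x v" if "x \<in> U" for x
    proof -
      interpret linear "fd g (f x)" by (rule linear_fd[OF dg[OF that]])
      have "fd g (f x) (fd f x v) = fd g (f x) (\<Sum>i\<in>Basis. (fd f x v \<bullet> i) *\<^sub>R i)"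
        by (simp add: euclidean_representation)
      also have "\<dots> = (\<Sum>i\<in>Basis. (fd f x v \<bullet> i) *\<^sub>R fd g (f x) i)" by (simp add: sum scale)
      finally show ?thesis using fd_eq[OF d[OF that]] by simp
    qed
  qed (rule Suc.prems)
  then show ?case using d by (auto simp: differentiable_def)
qed

lemma smooth_on_subset: "smooth_on U f \<Longrightarrow> V \<subseteq> U \<Longrightarrow> smooth_on V f"
  unfolding smooth_on_def using Ck_on_subset by blast

lemma smooth_on_cong:
  "smooth_on U f \<Longrightarrow> open U \<Longrightarrow> (\<And>x. x \<in> U \<Longrightarrow> f x = g x) \<Longrightarrow> smooth_on U g"
  unfolding smooth_on_def using Ck_on_cong by blast

lemma smooth_on_compose:
  fixes f :: "'a::real_normed_vector \<Rightarrow> 'b::euclidean_space"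
  shows "smooth_on V g \<Longrightarrow> smooth_on U f \<Longrightarrow> open U \<Longrightarrow> f ` U \<subseteq> V \<Longrightarrow> smooth_on U (\<lambda>x. g (f x))"
  unfolding smooth_on_def using Ck_on_compose by blast

lemma smooth_on_add:
  "smooth_on U f \<Longrightarrow> smooth_on U g \<Longrightarrow> open U \<Longrightarrow> smooth_on U (\<lambda>x. f x + g x)"
  unfolding smooth_on_def using Ck_on_add by blast

lemma smooth_on_const: "smooth_on U (\<lambda>x. c)"
  unfolding smooth_on_def using Ck_on_const by blast

lemma smooth_on_fd: "smooth_on U f \<Longrightarrow> smooth_on U (\<lambda>x. fd f x v)"
  unfolding smooth_on_def using Ck_on.simps(2) by blast

lemma smooth_on_differentiable: "smooth_on U f \<Longrightarrow> x \<in> U \<Longrightarrow> f differentiable (at x)"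
  unfolding smooth_on_def using Ck_on.simps(2) by blast

lemma smooth_on_continuous: "smooth_on U f \<Longrightarrow> continuous_on U f"
  unfolding smooth_on_def using Ck_on.simps(1) by blast

lemma smooth_on_bounded_linear:
  assumes "bounded_linear L" shows "smooth_on U L"
proof -
  have "Ck_on k UNIV (\<lambda>x. x)" for k :: nat
    by (cases k) (simp_all add: continuous_on_id Ck_on_const)
  then have "Ck_on k UNIV L" for k using Ck_on_linear[OF _ assms] by fastforce
  then show ?thesis unfolding smooth_on_def using Ck_on_subset by blast
qed

lemma smooth_on_linear:
  "smooth_on U f \<Longrightarrow> bounded_linear L \<Longrightarrow> open U \<Longrightarrow> smooth_on U (\<lambda>x. L (f x))"
  unfolding smooth_on_def using Ck_on_linear by blast

lemma smooth_on_Pair: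
  fixes f :: "'a::real_normed_vector \<Rightarrow> 'b::real_normed_vector" and g :: "'a \<Rightarrow> 'c::real_normed_vector"
  assumes "smooth_on U f" "smooth_on U g" "open U"
  shows "smooth_on U (\<lambda>x. (f x, g x))"
proof -
  have "smooth_on U (\<lambda>x. (f x, 0) + (0, g x))"
    using assms by (intro smooth_on_add smooth_on_linear[of U f "\<lambda>y. (y, 0)"]
        smooth_on_linear[of U g "\<lambda>y. (0, y)"]
        bounded_linear_Pair bounded_linear_ident bounded_linear_zero)
  then show ?thesis by simp
qed

section \<open>Symmetry of second derivatives\<close>

lemma line_mvt:
  fixes f :: "'a::real_normed_vector \<Rightarrow> real"
  assumes "0 < t" and d: "\<And>s. 0 \<le> s \<Longrightarrow> s \<le> t \<Longrightarrow> f differentiable (at (x + s *\<^sub>R u))"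
  shows "\<exists>s. 0 < s \<and> s < t \<and> f (x + t *\<^sub>R u) - f x = t * fd f (x + s *\<^sub>R u) u"
proof -
  have h: "((\<lambda>s. f (x + s *\<^sub>R u)) has_real_derivative fd f (x + s *\<^sub>R u) u) (at s)" 
    if "0 \<le> s" "s \<le> t" for s
  proof -
    have "((\<lambda>s. f (x + s *\<^sub>R u)) has_derivative (\<lambda>r. fd f (x + s *\<^sub>R u) (r *\<^sub>R u))) (at s)"
      by (rule has_derivative_compose[of "\<lambda>s. x + s *\<^sub>R u" _ s UNIV f, OF _ has_derivative_fd[OF d[OF that]]])
         (auto intro!: derivative_eq_intros)
    then show ?thesis
      by (rule has_derivative_imp_has_field_derivative)
         (simp add: linear_scale[OF linear_fd[OF d[OF that]]])
  qed
  obtain s where "0 < s" "s < t" "f (x + t *\<^sub>R u) - f (x + 0 *\<^sub>R u) = (t - 0) * fd f (x + s *\<^sub>R u) u"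
    using MVT2[OF assms(1), of "\<lambda>s. f (x + s *\<^sub>R u)" "\<lambda>s. fd f (x + s *\<^sub>R u) u"] h by auto
  then show ?thesis by auto
qed

text \<open>Applying the mean value theorem first to the increment of \<open>f\<close> in direction \<open>v\<close> and then to the
  derivative of \<open>f\<close> in direction \<open>u\<close> expresses the mixed second difference by one mixed second
  derivative. The second difference itself is symmetric in \<open>u\<close> and \<open>v\<close>.\<close>

lemma second_difference_quotient:
  fixes f :: "'a::real_normed_vector \<Rightarrow> real"
  assumes f: "Ck_on 2 U f" and t: "0 < t"
    and U: "\<And>r s. 0 \<le> r \<Longrightarrow> r \<le> t \<Longrightarrow> 0 \<le> s \<Longrightarrow> s \<le> t \<Longrightarrow> x + r *\<^sub>R u + s *\<^sub>R v \<in> U"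
  shows "\<exists>r s. 0 < r \<and> r < t \<and> 0 < s \<and> s < t \<and>
     f (x + t *\<^sub>R u + t *\<^sub>R v) - f (x + t *\<^sub>R u) - f (x + t *\<^sub>R v) + f x
       = t * t * fd (\<lambda>y. fd f y u) (x + r *\<^sub>R u + s *\<^sub>R v) v"
proof -
  have c1: "Ck_on 1 U (\<lambda>y. fd f y u)" using f by (simp add: numeral_2_eq_2)
  have df: "f differentiable (at y)" if "y \<in> U" for y using f that by (simp add: numeral_2_eq_2)
  have ddf: "(\<lambda>y. fd f y u) differentiable (at y)" if "y \<in> U" for y using c1 that by simp
  define F where "F = (\<lambda>y. f (y + t *\<^sub>R v) - f y)"
  have hF: "(F has_derivative (\<lambda>w. fd f (y + t *\<^sub>R v) w - fd f y w)) (at y)"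
    if "y \<in> U" "y + t *\<^sub>R v \<in> U" for y
  proof -
    have "((\<lambda>y. y + t *\<^sub>R v) has_derivative (\<lambda>w. w)) (at y)"
      by (auto intro!: derivative_eq_intros)
    then have "((\<lambda>y. f (y + t *\<^sub>R v)) has_derivative fd f (y + t *\<^sub>R v)) (at y)"
      by (rule has_derivative_compose[of "\<lambda>y. y + t *\<^sub>R v" "\<lambda>w. w" y UNIV f, OF _ has_derivative_fd[OF df[OF that(2)]]])
    then show ?thesis
      unfolding F_def using has_derivative_diff has_derivative_fd[OF df[OF that(1)]] by blast
  qed
  have in1: "x + r *\<^sub>R u \<in> U" "x + r *\<^sub>R u + t *\<^sub>R v \<in> U" if "0 \<le> r" "r \<le> t" for r
    using U[of r 0] U[of r t] that t by auto
  obtain r where r: "0 < r" "r < t" "F (x + t *\<^sub>R u) - F x = t * fd F (x + r *\<^sub>R u) u"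
  proof -
    have "F differentiable (at (x + r *\<^sub>R u))" if "0 \<le> r" "r \<le> t" for r
      using hF[OF in1[OF that]] unfolding differentiable_def by blast
    then show ?thesis using line_mvt[OF t, of F x u] that by blast
  qed
  have "fd F (x + r *\<^sub>R u) u = fd f (x + r *\<^sub>R u + t *\<^sub>R v) u - fd f (x + r *\<^sub>R u) u"
    using fd_eq[OF hF[OF in1[of r]]] r by simp
  moreover obtain s where s: "0 < s" "s < t"
    "fd f (x + r *\<^sub>R u + t *\<^sub>R v) u - fd f (x + r *\<^sub>R u) u
       = t * fd (\<lambda>y. fd f y u) (x + r *\<^sub>R u + s *\<^sub>R v) v"
  proof -
    have "(\<lambda>y. fd f y u) differentiable (at (x + r *\<^sub>R u + s *\<^sub>R v))" if "0 \<le> s" "s \<le> t" for s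
      using ddf U[of r s] r that by simp
    then show ?thesis using line_mvt[OF t, of "\<lambda>y. fd f y u" "x + r *\<^sub>R u" v] that by blast
  qed
  ultimately have "F (x + t *\<^sub>R u) - F x = t * t * fd (\<lambda>y. fd f y u) (x + r *\<^sub>R u + s *\<^sub>R v) v"
    using r(3) by simp
  moreover have "F (x + t *\<^sub>R u) - F x
      = f (x + t *\<^sub>R u + t *\<^sub>R v) - f (x + t *\<^sub>R u) - f (x + t *\<^sub>R v) + f x"
    by (simp add: F_def)
  ultimately have "f (x + t *\<^sub>R u + t *\<^sub>R v) - f (x + t *\<^sub>R u) - f (x + t *\<^sub>R v) + f x
      = t * t * fd (\<lambda>y. fd f y u) (x + r *\<^sub>R u + s *\<^sub>R v) v" by simp
  then show ?thesis using r(1,2) s(1,2) by blast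
qed

text \<open>For small \<open>t\<close> the mixed second difference, divided by \<open>t\<^sup>2\<close>, is a value of either mixed derivative
  close to \<open>x\<close>; by continuity both values are close to those at \<open>x\<close>.\<close>

lemma symmetric_second_derivative_real:
  fixes f :: "'a::real_normed_vector \<Rightarrow> real"
  assumes f: "Ck_on 2 U f" and U: "open U" "x \<in> U"
  shows "fd (\<lambda>y. fd f y u) x v = fd (\<lambda>y. fd f y v) x u"
proof (rule ccontr)
  let ?A = "\<lambda>y. fd (\<lambda>y. fd f y u) y v" and ?B = "\<lambda>y. fd (\<lambda>y. fd f y v) y u"
  assume ne: "?A x \<noteq> ?B x"
  define e where "e = \<bar>?A x - ?B x\<bar> / 2"
  have e: "e > 0" using ne by (simp add: e_def)
  have cA: "continuous_on U ?A" and cB: "continuous_on U ?B"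
    using f by (auto simp: numeral_2_eq_2)
  obtain d1 where d1: "d1 > 0" "ball x d1 \<subseteq> U" using U open_contains_ball by blast
  obtain d2 where d2: "d2 > 0" "\<And>y. y \<in> U \<Longrightarrow> dist y x < d2 \<Longrightarrow> dist (?A y) (?A x) < e"
    using cA U(2) e unfolding continuous_on_iff by blast
  obtain d3 where d3: "d3 > 0" "\<And>y. y \<in> U \<Longrightarrow> dist y x < d3 \<Longrightarrow> dist (?B y) (?B x) < e"
    using cB U(2) e unfolding continuous_on_iff by blast
  \<comment> \<open>The parallelogram with sides of length at most \<open>t\<close> in directions \<open>u\<close>, \<open>v\<close> stays within distance \<open>d\<close> of \<open>x\<close>.\<close>
  define d where "d = min d1 (min d2 d3)"
  define t where "t = d / (2 * (norm u + norm v + 1))"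
  have d: "d > 0" using d1 d2 d3 by (simp add: d_def)
  have n: "norm u + norm v + 1 > 0" by (simp add: add_nonneg_pos)
  have t: "t > 0" using d n by (simp add: t_def)
  have close: "dist (x + r *\<^sub>R a + s *\<^sub>R b) x < d"
    if "0 \<le> r" "r \<le> t" "0 \<le> s" "s \<le> t" "norm a + norm b = norm u + norm v" for r s a b
  proof -
    have "dist (x + r *\<^sub>R a + s *\<^sub>R b) x = norm (r *\<^sub>R a + s *\<^sub>R b)"
      by (simp add: dist_norm algebra_simps)
    also have "\<dots> \<le> r * norm a + s * norm b"
      using norm_triangle_ineq[of "r *\<^sub>R a" "s *\<^sub>R b"] that by simp
    also have "\<dots> \<le> t * norm a + t * norm b"
      using that by (intro add_mono mult_right_mono) auto
    also have "\<dots> = t * (norm u + norm v)" by (simp only: that(5) flip: distrib_left)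
    also have "\<dots> < t * (2 * (norm u + norm v + 1))"
    proof (rule mult_strict_left_mono[OF _ t])
      show "norm u + norm v < 2 * (norm u + norm v + 1)"
        by (simp add: add_nonneg_pos)
    qed
    also have "\<dots> = d"
      unfolding t_def using n by (metis less_irrefl nonzero_eq_divide_eq mult_pos_pos zero_less_numeral)
    finally show ?thesis .
  qed
  have inU: "x + r *\<^sub>R a + s *\<^sub>R b \<in> U"
    if "0 \<le> r" "r \<le> t" "0 \<le> s" "s \<le> t" "norm a + norm b = norm u + norm v" for r s a b
  proof -
    have "x + r *\<^sub>R a + s *\<^sub>R b \<in> ball x d1" using close[OF that] by (simp add: d_def dist_commute)
    then show ?thesis using d1 by blast
  qed
  define q where "q = f (x + t *\<^sub>R u + t *\<^sub>R v) - f (x + t *\<^sub>R u) - f (x + t *\<^sub>R v) + f x"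
  have q': "f (x + t *\<^sub>R v + t *\<^sub>R u) - f (x + t *\<^sub>R v) - f (x + t *\<^sub>R u) + f x = q"
    by (simp add: q_def algebra_simps)
  have inU1: "x + r *\<^sub>R u + s *\<^sub>R v \<in> U" if "0 \<le> r" "r \<le> t" "0 \<le> s" "s \<le> t" for r s
    using inU[OF that refl] .
  have inU2: "x + r *\<^sub>R v + s *\<^sub>R u \<in> U" if "0 \<le> r" "r \<le> t" "0 \<le> s" "s \<le> t" for r s
    using inU[OF that add.commute] .
  obtain r s where rs: "0 < r" "r < t" "0 < s" "s < t" "q = t * t * ?A (x + r *\<^sub>R u + s *\<^sub>R v)"
    using second_difference_quotient[OF f t inU1, folded q_def] by blast
  obtain r' s' where rs': "0 < r'" "r' < t" "0 < s'" "s' < t" "q = t * t * ?B (x + r' *\<^sub>R v + s' *\<^sub>R u)"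
    using second_difference_quotient[OF f t inU2, unfolded q'] by blast
  have "?A (x + r *\<^sub>R u + s *\<^sub>R v) = ?B (x + r' *\<^sub>R v + s' *\<^sub>R u)"
    using rs(5) rs'(5) t by simp
  moreover have "dist (?A (x + r *\<^sub>R u + s *\<^sub>R v)) (?A x) < e"
    using d2(2) inU[of r s u v] close[of r s u v] rs by (simp add: d_def)
  moreover have "dist (?B (x + r' *\<^sub>R v + s' *\<^sub>R u)) (?B x) < e"
    using d3(2) inU[of r' s' v u] close[of r' s' v u] rs' by (simp add: d_def add.commute)
  ultimately have "\<bar>?A x - ?B x\<bar> < 2 * e" unfolding dist_real_def by linarith
  then show False by (simp add: e_def)
qed

lemma symmetric_second_derivative:
  fixes f :: "'a::real_normed_vector \<Rightarrow> 'b::euclidean_space"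
  assumes f: "smooth_on U f" and U: "open U" "x \<in> U"
  shows "fd (\<lambda>y. fd f y u) x v = fd (\<lambda>y. fd f y v) x u"
proof (rule euclidean_eqI)
  fix i :: 'b assume "i \<in> Basis"
  have comp: "fd (\<lambda>y. F y \<bullet> i) y w = fd F y w \<bullet> i" if "F differentiable (at y)" for F :: "'a \<Rightarrow> 'b" and y w
    using fd_eq[OF bounded_linear.has_derivative[OF bounded_linear_inner_left has_derivative_fd[OF that]]] by simp
  have fi: "smooth_on U (\<lambda>y. f y \<bullet> i)"
    using smooth_on_linear[OF f bounded_linear_inner_left U(1)] .
  have "fd (\<lambda>y. fd f y a) x b \<bullet> i = fd (\<lambda>y. fd (\<lambda>y. f y \<bullet> i) y a) x b" for a b
  proof -
    have "fd (\<lambda>y. fd f y a) x b \<bullet> i = fd (\<lambda>y. fd f y a \<bullet> i) x b"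
      using comp smooth_on_differentiable[OF smooth_on_fd[OF f] U(2)] by simp
    also have "\<dots> = fd (\<lambda>y. fd (\<lambda>y. f y \<bullet> i) y a) x b"
      using fd_eq_open[OF U, of "\<lambda>y. fd f y a \<bullet> i" "\<lambda>y. fd (\<lambda>y. f y \<bullet> i) y a"]
        comp smooth_on_differentiable[OF f] by simp
    finally show ?thesis .
  qed
  then show "fd (\<lambda>y. fd f y u) x v \<bullet> i = fd (\<lambda>y. fd f y v) x u \<bullet> i"
    using symmetric_second_derivative_real[OF _ U, of "\<lambda>y. f y \<bullet> i"] fi
    unfolding smooth_on_def by simp
qed

section \<open>Algebraic curvature tensors in dimension four\<close>

lemma linear_eq_0_if_0_on_generators:
  assumes "linear f" "\<And>v. v = (\<Sum>e\<in>E. c v e *\<^sub>R e)" "\<And>e. e \<in> E \<Longrightarrow> f e = 0"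
  shows "f v = 0"
proof -
  have "f v = (\<Sum>e\<in>E. c v e *\<^sub>R f e)"
    using assms(2)[of v] linear_sum[OF assms(1), of "\<lambda>e. c v e *\<^sub>R e" E] linear_scale[OF assms(1)]
    by simp
  then show ?thesis using assms(3) by simp
qed

definition orthogonal_frame :: "('e::euclidean_space \<Rightarrow> 'e \<Rightarrow> real) \<Rightarrow> 'e set \<Rightarrow> bool" where
  "orthogonal_frame h E \<longleftrightarrow> finite E \<and> (\<forall>e\<in>E. h e e \<noteq> 0) \<and>
     (\<forall>e\<in>E. \<forall>f\<in>E. e \<noteq> f \<longrightarrow> h e f = 0)"

text \<open>The signature is left open, so that both sign conventions for Lorentzian metrics are covered, and the
  complement of a non-null vector may be definite or Lorentzian.\<close>

locale nondegenerate_form =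
  fixes h :: "'e::euclidean_space \<Rightarrow> 'e \<Rightarrow> real"
  assumes bilin: "bilinear h"
    and sym: "h u v = h v u"
    and nondeg: "(\<And>w. h u w = 0) \<Longrightarrow> u = 0"
begin

lemma linear1: "linear (\<lambda>u. h u v)" and linear2: "linear (h u)"
  using bilin by (auto simp: bilinear_def)

lemmas form_simps =
  linear_add[OF linear1] linear_scale[OF linear1] linear_diff[OF linear1] linear_neg[OF linear1]
  linear_0[OF linear1] linear_sum[OF linear1]
  linear_add[OF linear2] linear_scale[OF linear2] linear_diff[OF linear2] linear_neg[OF linear2]
  linear_0[OF linear2] linear_sum[OF linear2]

lemma form_eqI:
  assumes "\<And>w. h u w = h v w" shows "u = v"
proof -
  have "u - v = 0" by (rule nondeg) (simp add: form_simps assms)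
  then show ?thesis by simp
qed

text \<open>The musical isomorphism. It gives existence and uniqueness of the Christoffel symbols.\<close>

lemma form_representation:
  assumes "linear \<phi>" shows "\<exists>!z. \<forall>w. h z w = \<phi> w"
proof (rule ex_ex1I)
  define F where "F = (\<lambda>z. \<Sum>i\<in>Basis. h z i *\<^sub>R i)"
  have lin: "linear F"
    by (intro linearI)
      (simp_all add: F_def form_simps scaleR_add_left sum.distrib scaleR_sum_right)
  have eq: "h z w = (\<Sum>i\<in>Basis. (w \<bullet> i) * h z i)" for z w
  proof -
    have "h z w = h z (\<Sum>i\<in>Basis. (w \<bullet> i) *\<^sub>R i)" by (simp add: euclidean_representation)
    then show ?thesis by (simp add: form_simps)
  qed
  have comp: "F z \<bullet> i = h z i" if "i \<in> Basis" for z i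
    using that by (simp add: F_def inner_sum_left_Basis)
  have "inj F"
  proof (subst linear_injective_0[OF lin], intro allI impI)
    fix z assume "F z = 0"
    then have "h z i = 0" if "i \<in> Basis" for i using comp[OF that, of z] by simp
    then show "z = 0" by (intro nondeg) (subst eq, simp)
  qed
  then have "surj F" by (rule linear_injective_imp_surjective[OF lin]) simp
  then obtain z where z: "F z = (\<Sum>i\<in>Basis. \<phi> i *\<^sub>R i)" by (metis surjD)
  have "h z w = \<phi> w" for w
  proof -
    have "\<phi> w = \<phi> (\<Sum>i\<in>Basis. (w \<bullet> i) *\<^sub>R i)" by (simp add: euclidean_representation)
    also have "\<dots> = (\<Sum>i\<in>Basis. (w \<bullet> i) * \<phi> i)"
      by (simp add: linear_sum[OF assms] linear_scale[OF assms])
    also have "\<dots> = h z w"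
      unfolding eq[of z w] using comp[of _ z] z by (intro sum.cong) auto
    finally show ?thesis by simp
  qed
  then show "\<exists>z. \<forall>w. h z w = \<phi> w" by blast
  show "\<And>z z'. \<forall>w. h z w = \<phi> w \<Longrightarrow> \<forall>w. h z' w = \<phi> w \<Longrightarrow> z = z'"
    by (intro form_eqI) simp
qed

lemma frame_component:
  assumes "orthogonal_frame h E" "e \<in> E"
  shows "h (\<Sum>f\<in>E. c f *\<^sub>R f) e = c e * h e e"
proof -
  have "h (\<Sum>f\<in>E. c f *\<^sub>R f) e = (\<Sum>f\<in>E. if f = e then c e * h e e else 0)"
    unfolding form_simps using assms by (intro sum.cong) (auto simp: orthogonal_frame_def form_simps)
  then show ?thesis using assms by (simp add: orthogonal_frame_def)
qed

lemma frame_independent: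
  assumes "orthogonal_frame h E" shows "independent E"
proof (rule independent_if_scalars_zero)
  show "finite E" using assms by (simp add: orthogonal_frame_def)
  fix c e assume "(\<Sum>f\<in>E. c f *\<^sub>R f) = 0" "e \<in> E"
  then show "c e = 0" using frame_component[OF assms, of e c] assms
    by (simp add: orthogonal_frame_def form_simps)
qed

text \<open>An orthogonal family of non-null vectors of maximal cardinality is a basis: if every vector of
  its orthogonal complement is null, then the form vanishes on the complement by polarization, so
  the complement is in the radical, which is zero.\<close>

lemma orthogonal_frame_exists:
  assumes T: "h T T \<noteq> 0"
  shows "\<exists>E. orthogonal_frame h E \<and> T \<in> E \<and> card E = DIM('e) \<and>
    (\<forall>v. v = (\<Sum>e\<in>E. (h v e / h e e) *\<^sub>R e))"
proof -
  define P where "P = (\<lambda>E. orthogonal_frame h E \<and> T \<in> E)"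
  have "P {T}" using T by (simp add: P_def orthogonal_frame_def)
  moreover have "card E < Suc DIM('e)" if "P E" for E
    using that independent_card_le[OF frame_independent] by (auto simp: P_def less_Suc_eq_le)
  ultimately obtain E where E: "P E" and max: "\<And>F. P F \<Longrightarrow> card F \<le> card E"
    using ex_has_greatest_nat[of P "{T}" card "Suc DIM('e)"] by blast
  have fr: "orthogonal_frame h E" and fin: "finite E" using E by (auto simp: P_def orthogonal_frame_def)
  \<comment> \<open>Otherwise \<open>u\<close> could be added to the frame.\<close>
  have perp_null: "h u u = 0" if u: "\<And>e. e \<in> E \<Longrightarrow> h u e = 0" for u
  proof (rule ccontr)
    assume n: "h u u \<noteq> 0"
    then have "u \<notin> E" using u by blast
    moreover have "h e u = 0" if "e \<in> E" for e using u[OF that] sym[of e u] by simp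
    ultimately have "P (insert u E)" using E n u by (simp add: P_def orthogonal_frame_def)
    moreover note \<open>u \<notin> E\<close>
    ultimately show False using max[of "insert u E"] fin by simp
  qed
  define pr where "pr = (\<lambda>v. \<Sum>e\<in>E. (h v e / h e e) *\<^sub>R e)"
  have pr: "h (v - pr v) e = 0" if "e \<in> E" for v e
    using frame_component[OF fr that, of "\<lambda>e. h v e / h e e"] fr that
    by (simp add: pr_def form_simps orthogonal_frame_def)
  have perp_0: "u = 0" if u: "\<And>e. e \<in> E \<Longrightarrow> h u e = 0" for u
  proof (rule nondeg)
    fix w
    have perp: "h u' w' = 0" if "\<And>e. e \<in> E \<Longrightarrow> h u' e = 0" "\<And>e. e \<in> E \<Longrightarrow> h w' e = 0" for u' w'
    proof -
      have "h (u' + w') (u' + w') = 0" by (rule perp_null) (simp add: form_simps that)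
      then show ?thesis using perp_null[of u'] perp_null[of w'] that sym[of u' w'] by (simp add: form_simps)
    qed
    have "h u w = h u (w - pr w) + h u (pr w)" by (simp add: form_simps)
    moreover have "h u (w - pr w) = 0" by (rule perp) (use u pr in auto)
    moreover have "h u (pr w) = 0" by (simp add: pr_def form_simps u)
    ultimately show "h u w = 0" by simp
  qed
  have rep: "pr v = v" for v
    using perp_0[of "v - pr v"] pr by simp
  have "span E = UNIV"
  proof -
    have "pr v \<in> span E" for v
      unfolding pr_def by (intro span_sum span_scale span_base)
    then show ?thesis using rep by auto
  qed
  then have "card E = DIM('e)"
    using dim_span_eq_card_independent[OF frame_independent[OF fr]] by simp
  moreover have "\<forall>v. v = (\<Sum>e\<in>E. (h v e / h e e) *\<^sub>R e)"
    by (intro allI) (rule rep[unfolded pr_def, symmetric])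
  ultimately show ?thesis using fr E unfolding P_def by (intro exI conjI) simp_all
qed

text \<open>Connects the Ricci tensor, defined as a trace in the standard basis, with a frame adapted to the
  metric.\<close>

lemma trace_in_frame:
  assumes "linear L" and rep: "\<And>v. v = (\<Sum>e\<in>E. (h v e / h e e) *\<^sub>R e)"
  shows "(\<Sum>i\<in>Basis. L i \<bullet> i) = (\<Sum>e\<in>E. h (L e) e / h e e)"
proof -
  have L: "L i = (\<Sum>e\<in>E. (h i e / h e e) *\<^sub>R L e)" for i
  proof -
    have "L i = L (\<Sum>e\<in>E. (h i e / h e e) *\<^sub>R e)" by (rule arg_cong[OF rep])
    also have "\<dots> = (\<Sum>e\<in>E. (h i e / h e e) *\<^sub>R L e)"
      by (simp add: linear_sum[OF assms(1)] linear_scale[OF assms(1)])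
    finally show ?thesis .
  qed
  have "(\<Sum>i\<in>Basis. L i \<bullet> i) = (\<Sum>i\<in>Basis. \<Sum>e\<in>E. h i e / h e e * (L e \<bullet> i))"
    by (intro sum.cong refl, subst L) (simp add: inner_sum_left)
  also have "\<dots> = (\<Sum>e\<in>E. \<Sum>i\<in>Basis. h i e / h e e * (L e \<bullet> i))"
    by (rule sum.swap)
  also have "\<dots> = (\<Sum>e\<in>E. h (\<Sum>i\<in>Basis. (L e \<bullet> i) *\<^sub>R i) e / h e e)"
    by (simp add: form_simps sum_divide_distrib mult.commute)
  finally show ?thesis by (simp add: euclidean_representation)
qed

end

locale curvature_like = nondegenerate_form h for h :: "'e::euclidean_space \<Rightarrow> 'e \<Rightarrow> real" +
  fixes R :: "'e \<Rightarrow> 'e \<Rightarrow> 'e \<Rightarrow> 'e"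
  assumes R_linear1: "linear (\<lambda>u. R u v w)"
    and R_linear3: "linear (R u v)"
    and R_skew: "R u v w = - R v u w"
    and R_metric: "h (R u v w) z = - h w (R u v z)"
    and R_bianchi: "R u v w + R v w u + R w u v = 0"
begin

text \<open>The usual argument: in the sum of the Bianchi identities for the four cyclic shifts of the
  arguments all terms cancel in pairs except for twice the difference of the two sides.\<close>

lemma R_pair_symmetry: "h (R u v w) z = h (R w z u) v"
proof -
  let ?r = "\<lambda>u v w z. h (R u v w) z"
  have b: "?r u v w z + ?r v w u z + ?r w u v z = 0" for u v w z
  proof -
    have "h (R u v w + R v w u + R w u v) z = 0" unfolding R_bianchi form_simps ..
    then show ?thesis by (simp add: form_simps)
  qed
  have s1: "?r u v w z = - ?r v u w z" for u v w z
    using R_skew[of u v w] by (simp add: form_simps)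
  have s2: "?r u v w z = - ?r u v z w" for u v w z
    using R_metric[of u v w z] sym[of w "R u v z"] by simp
  have "?r w u v z = ?r v z w u" for u v w z
    using b[of u v w z] b[of v w z u] b[of w z u v] b[of z u v w]
      s2[of u v w z] s2[of v w u z] s2[of w z u v] s2[of z u v w]
      s1[of u w z v] s2[of w u z v] s1[of v z u w] s2[of z v u w] s1[of z v w u]
    by linarith
  then show ?thesis .
qed

text \<open>Since the Ricci tensor vanishes on \<open>T\<close> while \<open>h T T \<noteq> 0\<close>, the Einstein constant is zero. All components
  of the curvature that involve \<open>T\<close> vanish by the symmetries of \<open>R\<close>, so in an orthogonal frame
  \<open>T, a, b, c\<close> the Ricci tensor is a trace over \<open>a, b, c\<close> only. Up to nonzero factors, its off-diagonal
  entries are the three components with one repeated index, and its diagonal entries are weighted sums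
  of two of the three sectional components, a system with the unique solution zero.\<close>

theorem flat_if_einstein_with_parallel_vector:
  assumes dim: "DIM('e) = 4"
    and parallel: "\<And>u v. R u v T = 0" and T: "h T T \<noteq> 0"
    and einstein: "\<And>v w. (\<Sum>i\<in>Basis. R i v w \<bullet> i) = \<Lambda> * h v w"
  shows "R u v w = 0"
proof -
  define r where "r = (\<lambda>u v w z. h (R u v w) z)"
  have "\<Lambda> * h T T = 0" using einstein[of T T] parallel by simp
  then have \<Lambda>: "\<Lambda> = 0" using T by simp
  obtain E where fr: "orthogonal_frame h E" and TE: "T \<in> E" and card: "card E = 4"
    and rep: "\<And>v. v = (\<Sum>e\<in>E. (h v e / h e e) *\<^sub>R e)"
    by (rule exE[OF orthogonal_frame_exists[OF T, unfolded dim]]) (elim conjE, rule that, assumption+, rule spec)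
  have "card (E - {T}) = 3" using TE card by simp
  then obtain a b c where abc: "E - {T} = {a, b, c}" "a \<noteq> b" "b \<noteq> c" "a \<noteq> c"
    unfolding card_3_iff by blast
  have E: "E = {T, a, b, c}" and "T \<noteq> a" "T \<noteq> b" "T \<noteq> c" using TE abc(1) by blast+
  have sq: "h a a \<noteq> 0" "h b b \<noteq> 0" "h c c \<noteq> 0" using fr E by (auto simp: orthogonal_frame_def)
  have s1: "r u v w z = - r v u w z" for u v w z
    using R_skew[of u v w] by (simp add: r_def form_simps)
  have s2: "r u v w z = - r u v z w" for u v w z
    using R_metric[of u v w z] sym[of w "R u v z"] by (simp add: r_def)
  have s3: "r u v w z = r w z u v" for u v w z
    unfolding r_def by (rule R_pair_symmetry)
  have rT: "r u v T z = 0" for u v z using parallel by (simp add: r_def form_simps)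
  have rT': "r u v z T = 0" "r T u v z = 0" "r u T v z = 0" for u v z
    using rT[of u v z] rT[of v z u] rT[of v z u] s2[of u v z T] s3[of T u v z]
      s1[of u T v z] by simp_all
  have r0: "r u u w z = 0" "r w z u u = 0" for u w z
    using s1[of u u w z] s2[of w z u u] by simp_all
  have ric: "r a v w a / h a a + r b v w b / h b b + r c v w c / h c c = 0" for v w
  proof -
    have "0 = (\<Sum>i\<in>Basis. R i v w \<bullet> i)" using einstein[of v w] \<Lambda> by simp
    also have "\<dots> = (\<Sum>e\<in>E. r e v w e / h e e)"
      unfolding r_def by (rule trace_in_frame[OF R_linear1 rep])
    finally show ?thesis
      using E abc(2-) \<open>T \<noteq> a\<close> \<open>T \<noteq> b\<close> \<open>T \<noteq> c\<close> by (simp add: rT')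
  qed
  \<comment> \<open>Each off-diagonal Ricci component has a single surviving term.\<close>
  have off: "r a b c a = 0" "r b a c b = 0" "r c a b c = 0"
    using ric[of b c] ric[of a c] ric[of a b] sq by (simp_all add: r0)
  have diag: "r a b a b = 0" "r a c a c = 0" "r b c b c = 0"
  proof -
    \<comment> \<open>The diagonal Ricci components, with denominators cleared.\<close>
    have 1: "r b a a b * h c c + r c a a c * h b b = 0"
      using ric[of a a] sq by (simp add: r0 add_frac_eq)
    have 2: "r a b b a * h c c + r c b b c * h a a = 0"
      using ric[of b b] sq by (simp add: r0 add_frac_eq)
    have 3: "r a c c a * h b b + r b c c b * h a a = 0"
      using ric[of c c] sq by (simp add: r0 add_frac_eq)
    have 4: "r b a a b = - r a b a b" "r c a a c = - r a c a c" "r c b b c = - r b c b c"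
      by (rule s1)+
    have 5: "r a b b a = - r a b a b" "r a c c a = - r a c a c" "r b c c b = - r b c b c"
      by (rule s2)+
    have "r a b a b * h c c + r a c a c * h b b = 0" "r a b a b * h c c + r b c b c * h a a = 0"
      "r a c a c * h b b + r b c b c * h a a = 0"
      using 1 2 3 unfolding 4 5 by linarith+
    then have "r a b a b * h c c = 0" "r a c a c * h b b = 0" "r b c b c * h a a = 0"
      by linarith+
    then show "r a b a b = 0" "r a c a c = 0" "r b c b c = 0" using sq by simp_all
  qed
  have s1': "r b a w z = - r a b w z" "r c a w z = - r a c w z" "r c b w z = - r b c w z" for w z
    by (rule s1)+
  have s2': "r w z b a = - r w z a b" "r w z c a = - r w z a c" "r w z c b = - r w z b c" for w z
    by (rule s2)+
  have mixed: "r a b a c = 0" "r a b b c = 0" "r a c b c = 0"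
    using off by (simp_all add: s1' s2')
  then have mixed': "r a c a b = 0" "r b c a b = 0" "r b c a c = 0"
    using s3[of a c a b] s3[of b c a b] s3[of b c a c] by simp_all
  have "\<forall>e1\<in>E. \<forall>e2\<in>E. \<forall>e3\<in>E. \<forall>e4\<in>E. r e1 e2 e3 e4 = 0"
    unfolding E by (simp add: rT rT' r0 s1' s2' diag mixed mixed')
  then have frame0: "r e1 e2 e3 e4 = 0" if "e1 \<in> E" "e2 \<in> E" "e3 \<in> E" "e4 \<in> E" for e1 e2 e3 e4
    using that by blast
  note zero = linear_eq_0_if_0_on_generators[OF _ rep]
  have R_linear2: "linear (\<lambda>v. R u v w)" for u w
    using linear_compose_neg[OF R_linear1[of u w]] R_skew[of u _ w] by simp
  have lin: "linear (\<lambda>u. r u v w z)" "linear (\<lambda>v. r u v w z)" "linear (\<lambda>w. r u v w z)"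
      "linear (r u v w)" for u v w z
    using linear_compose[OF R_linear1[of v w] linear1[of z]] linear_compose[OF R_linear2[of u w] linear1[of z]]
      linear_compose[OF R_linear3[of u v] linear1[of z]] linear2
    by (simp_all add: r_def o_def)
  have "r u v w z = 0" for z
  proof (rule zero[OF lin(1)], rule zero[OF lin(2)], rule zero[OF lin(3)], rule zero[OF lin(4)])
  qed (rule frame0)
  then show ?thesis unfolding r_def by (rule nondeg)
qed

end

section \<open>Families of linear and bilinear maps\<close>

text \<open>The product rule for the evaluation of a linear map depending on a point at a vector depending on
  the same point. The maps \<open>F y\<close> are only required to be linear near \<open>x\<close>, and the derivative of \<open>F\<close> is
  taken with the argument held fixed, as in the coordinate formulas for tensor fields.\<close>

lemma linear_family_product_rule:
  fixes F :: "'a::real_normed_vector \<Rightarrow> 'b::euclidean_space \<Rightarrow> 'c::real_normed_vector"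
  assumes X: "open X" "x \<in> X" and lin: "\<And>y. y \<in> X \<Longrightarrow> linear (F y)"
    and dF: "\<And>u. (\<lambda>y. F y u) differentiable (at x)" and da: "(a has_derivative a') (at x)"
  shows "((\<lambda>y. F y (a y)) has_derivative (\<lambda>v. fd (\<lambda>y. F y (a x)) x v + F x (a' v))) (at x)"
proof -
  have expand: "F y u = (\<Sum>i\<in>Basis. (u \<bullet> i) *\<^sub>R F y i)" if "y \<in> X" for y u
  proof -
    have "F y u = F y (\<Sum>i\<in>Basis. (u \<bullet> i) *\<^sub>R i)" by (simp add: euclidean_representation)
    also have "\<dots> = (\<Sum>i\<in>Basis. (u \<bullet> i) *\<^sub>R F y i)"
      by (simp add: linear_sum[OF lin[OF that]] linear_scale[OF lin[OF that]])
    finally show ?thesis .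
  qed
  have s: "((\<lambda>y. \<Sum>i\<in>Basis. (b y \<bullet> i) *\<^sub>R F y i) has_derivative
      (\<lambda>v. \<Sum>i\<in>Basis. (b x \<bullet> i) *\<^sub>R fd (\<lambda>y. F y i) x v + (b' v \<bullet> i) *\<^sub>R F x i)) (at x)"
    if "(b has_derivative b') (at x)" for b b'
    by (intro has_derivative_sum has_derivative_scaleR has_derivative_fd dF
        bounded_linear.has_derivative[OF bounded_linear_inner_left] that)
  have "((\<lambda>y. F y (a x)) has_derivative
      (\<lambda>v. \<Sum>i\<in>Basis. (a x \<bullet> i) *\<^sub>R fd (\<lambda>y. F y i) x v + (0 \<bullet> i) *\<^sub>R F x i)) (at x)"
    by (rule has_derivative_transform_within_open[OF s[OF has_derivative_const] X])
      (rule expand[symmetric])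
  from fd_eq[OF this]
  have const: "fd (\<lambda>y. F y (a x)) x v = (\<Sum>i\<in>Basis. (a x \<bullet> i) *\<^sub>R fd (\<lambda>y. F y i) x v)" for v
    by simp
  have "((\<lambda>y. F y (a y)) has_derivative
      (\<lambda>v. \<Sum>i\<in>Basis. (a x \<bullet> i) *\<^sub>R fd (\<lambda>y. F y i) x v + (a' v \<bullet> i) *\<^sub>R F x i)) (at x)"
    by (rule has_derivative_transform_within_open[OF s[OF da] X]) (rule expand[symmetric])
  then show ?thesis
    unfolding const expand[OF X(2), of "a' v" for v] sum.distrib .
qed

lemma fd_linear_family:
  assumes X: "open X" "x \<in> X" and lin: "\<And>y. y \<in> X \<Longrightarrow> linear (F y)"
    and dF: "\<And>u. (\<lambda>y. F y u) differentiable (at x)"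
  shows "linear (\<lambda>u. fd (\<lambda>y. F y u) x v)"
proof (rule linearI)
  have d: "((\<lambda>y. F y u) has_derivative fd (\<lambda>y. F y u) x) (at x)" for u
    by (rule has_derivative_fd[OF dF])
  show "fd (\<lambda>y. F y (u + w)) x v = fd (\<lambda>y. F y u) x v + fd (\<lambda>y. F y w) x v" for u w
  proof -
    have "fd (\<lambda>y. F y (u + w)) x = fd (\<lambda>y. F y u + F y w) x"
      by (rule fd_eq_open[OF X]) (simp add: linear_add[OF lin])
    then show ?thesis by (simp add: fd_eq[OF has_derivative_add[OF d d]])
  qed
  show "fd (\<lambda>y. F y (r *\<^sub>R u)) x v = r *\<^sub>R fd (\<lambda>y. F y u) x v" for r u
  proof -
    have "fd (\<lambda>y. F y (r *\<^sub>R u)) x = fd (\<lambda>y. r *\<^sub>R F y u) x"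
      by (rule fd_eq_open[OF X]) (simp add: linear_scale[OF lin])
    then show ?thesis by (simp add: fd_eq[OF has_derivative_scaleR_right[OF d]])
  qed
qed

lemma bilinear_family_product_rule:
  fixes H :: "'a::real_normed_vector \<Rightarrow> 'b::euclidean_space \<Rightarrow> 'b \<Rightarrow> 'c::real_normed_vector"
  assumes X: "open X" "x \<in> X" and bil: "\<And>y. y \<in> X \<Longrightarrow> bilinear (H y)"
    and dH: "\<And>u v. (\<lambda>y. H y u v) differentiable (at x)"
    and da: "(a has_derivative a') (at x)" and db: "(b has_derivative b') (at x)"
  shows "((\<lambda>y. H y (a y) (b y)) has_derivative
    (\<lambda>v. fd (\<lambda>y. H y (a x) (b x)) x v + H x (a' v) (b x) + H x (a x) (b' v))) (at x)"
proof -
  have l1: "linear (\<lambda>u. H y u w)" and l2: "linear (H y u)" if "y \<in> X" for y u w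
    using bil[OF that] by (auto simp: bilinear_def)
  have d1: "((\<lambda>y. H y u (b y)) has_derivative (\<lambda>v. fd (\<lambda>y. H y u (b x)) x v + H x u (b' v))) (at x)" for u
    by (rule linear_family_product_rule[where F="\<lambda>y. H y u" and X=X]) (use X l2 dH db in auto)
  have "((\<lambda>y. H y (a y) (b y)) has_derivative
    (\<lambda>v. fd (\<lambda>y. H y (a x) (b y)) x v + H x (a' v) (b x))) (at x)"
    by (rule linear_family_product_rule[where F="\<lambda>y u. H y u (b y)" and X=X])
      (use X l1 da d1[THEN differentiableI] in auto)
  then show ?thesis by (simp add: fd_eq[OF d1] add_ac)
qed

text \<open>Implicit differentiation of a linear equation. The candidate \<open>L\<close> for the derivative of \<open>z\<close> comes from
  differentiating \<open>F y (z y) = k y\<close>. The residual of the affine approximation of \<open>z\<close> in the equation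
  vanishes to first order, and near \<open>x\<close> the maps \<open>F y\<close> are bounded below uniformly, so the error
  of the approximation itself vanishes to first order.\<close>

lemma differentiable_solution:
  fixes F :: "'a::euclidean_space \<Rightarrow> 'b::euclidean_space \<Rightarrow> 'b"
  assumes X: "open X" "x \<in> X" and lin: "\<And>y. y \<in> X \<Longrightarrow> linear (F y)"
    and dF: "\<And>u. (\<lambda>y. F y u) differentiable (at x)" and inj: "inj (F x)"
    and dk: "k differentiable (at x)" and sol: "\<And>y. y \<in> X \<Longrightarrow> F y (z y) = k y"
  shows "z differentiable (at x)"
proof -
  have linx: "linear (F x)" using lin X by blast
  obtain c where c: "c > 0" "\<And>u. c * norm u \<le> norm (F x u)"
    using linear_inj_bounded_below_pos[OF linx inj] by metis
  have surj: "surj (F x)" by (rule linear_injective_imp_surjective[OF linx inj]) simp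
  obtain G where G: "linear G" "F x \<circ> G = id"
    using linear_surjective_right_inverse[OF linx surj] by blast
  define L where "L = (\<lambda>v. G (fd k x v - fd (\<lambda>y. F y (z x)) x v))"
  have "linear (G \<circ> (\<lambda>v. fd k x v - fd (\<lambda>y. F y (z x)) x v))"
    by (intro linear_compose[OF _ G(1)] linear_compose_sub linear_fd dk dF)
  then have linL: "bounded_linear L"
    unfolding L_def o_def by (simp only: linear_conv_bounded_linear)
  have FL: "F x (L v) = fd k x v - fd (\<lambda>y. F y (z x)) x v" for v
    using G(2) by (simp add: L_def fun_eq_iff)
  \<comment> \<open>The residual of the affine approximation.\<close>
  define r where "r = (\<lambda>y. k y - F y (z x + L (y - x)))"
  have dr: "(r has_derivative (\<lambda>v. 0)) (at x)"
  proof -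
    have "((\<lambda>y. y - x) has_derivative (\<lambda>v. v)) (at x)"
      by (auto intro!: derivative_eq_intros)
    from bounded_linear.has_derivative[OF linL this]
    have "((\<lambda>y. z x + L (y - x)) has_derivative L) (at x)"
      by (auto intro!: derivative_eq_intros)
    then have "(r has_derivative (\<lambda>v. fd k x v -
        (fd (\<lambda>y. F y (z x + L (x - x))) x v + F x (L v)))) (at x)"
      unfolding r_def
      by (intro has_derivative_diff has_derivative_fd dk linear_family_product_rule[OF X lin dF])
    then show ?thesis using bounded_linear.linear[OF linL] by (simp add: FL linear_0)
  qed
  have r0: "r x = 0" using sol[OF X(2)] bounded_linear.linear[OF linL] by (simp add: r_def linear_0)
  define S where "S = (\<lambda>y. \<Sum>i\<in>Basis. norm (F y i - F x i))"
  have "isCont S x"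
    unfolding S_def
    by (intro continuous_intros differentiable_imp_continuous_within dF)
  then have "(S \<longlongrightarrow> 0) (at x)"
    unfolding isCont_def by (simp add: S_def)
  then have "eventually (\<lambda>y. S y < c / 2) (at x)"
    using order_tendstoD(2) c(1) half_gt_zero by blast
  then obtain d0 where d0: "d0 > 0" "\<And>y. y \<noteq> x \<Longrightarrow> dist y x < d0 \<Longrightarrow> S y < c / 2"
    unfolding eventually_at by auto
  obtain d1 where d1: "d1 > 0" "ball x d1 \<subseteq> X" using X open_contains_ball by blast
  have low: "c / 2 * norm u \<le> norm (F y u)" if y: "dist y x < d0" "dist y x < d1" for y u
  proof -
    have yX: "y \<in> X" using y(2) d1(2) by (auto simp: dist_commute)
    have "S y \<le> c / 2" using d0(2)[of y] y c(1) by (cases "y = x") (auto simp: S_def)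
    have "F y u - F x u = (\<Sum>i\<in>Basis. (u \<bullet> i) *\<^sub>R (F y i - F x i))"
    proof -
      have "F w u = (\<Sum>i\<in>Basis. (u \<bullet> i) *\<^sub>R F w i)" if "w \<in> X" for w
      proof -
        have "F w u = F w (\<Sum>i\<in>Basis. (u \<bullet> i) *\<^sub>R i)" by (simp add: euclidean_representation)
        then show ?thesis
          by (simp add: linear_sum[OF lin[OF that]] linear_scale[OF lin[OF that]])
      qed
      then show ?thesis using yX X(2) by (simp add: sum_subtractf scaleR_diff_right)
    qed
    also have "norm \<dots> \<le> (\<Sum>i\<in>Basis. norm ((u \<bullet> i) *\<^sub>R (F y i - F x i)))" by (rule norm_sum)
    also have "\<dots> \<le> (\<Sum>i\<in>Basis. norm u * norm (F y i - F x i))"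
      by (intro sum_mono) (auto intro!: mult_right_mono Basis_le_norm)
    also have "\<dots> = norm u * S y" by (simp add: S_def sum_distrib_left)
    also have "\<dots> \<le> norm u * (c / 2)" using \<open>S y \<le> c / 2\<close> by (intro mult_left_mono) auto
    finally have "norm (F y u - F x u) \<le> norm u * (c / 2)" .
    moreover have "norm (F x u) \<le> norm (F y u) + norm (F y u - F x u)"
      using norm_triangle_ineq4[of "F y u" "F y u - F x u"] by simp
    ultimately show ?thesis using c(2)[of u] by (simp add: field_simps)
  qed
  have "(z has_derivative L) (at x)"
    unfolding has_derivative_at_alt
  proof (intro conjI linL allI impI)
    fix e :: real assume "e > 0"
    then have "c / 2 * e > 0" using c(1) by simp
    then obtain d where d: "d > 0"
      "\<And>y. norm (y - x) < d \<Longrightarrow> norm (r y - r x - 0) \<le> (c / 2 * e) * norm (y - x)"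
      using dr unfolding has_derivative_at_alt by blast
    show "\<exists>d>0. \<forall>y. norm (y - x) < d \<longrightarrow> norm (z y - z x - L (y - x)) \<le> e * norm (y - x)"
    proof (intro exI[of _ "min d (min d0 d1)"] conjI allI impI)
      fix y assume y: "norm (y - x) < min d (min d0 d1)"
      then have "dist y x < d0" "dist y x < d1" by (auto simp: dist_norm)
      then have yX: "y \<in> X" using d1(2) by (auto simp: dist_commute)
      have "F y (z y - z x - L (y - x)) = r y"
        by (simp add: r_def sol[OF yX, symmetric] linear_diff[OF lin[OF yX]] linear_add[OF lin[OF yX]])
      then have "c / 2 * norm (z y - z x - L (y - x)) \<le> norm (r y)"
        using low[OF \<open>dist y x < d0\<close> \<open>dist y x < d1\<close>] by metis
      also have "\<dots> \<le> (c / 2 * e) * norm (y - x)" using d(2)[of y] y r0 by simp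
      finally have "c / 2 * norm (z y - z x - L (y - x)) \<le> c / 2 * (e * norm (y - x))" by simp
      then show "norm (z y - z x - L (y - x)) \<le> e * norm (y - x)" using c(1) by simp
    qed (use d d0 d1 in auto)
  qed
  then show ?thesis by (auto simp: differentiable_def)
qed

section \<open>Levi-Civita connection and curvature on an open set\<close>

locale local_metric =
  fixes X :: "'e::euclidean_space set" and h :: "'e \<Rightarrow> 'e \<Rightarrow> 'e \<Rightarrow> real"
  assumes open_X: "open X"
    and h_bilinear: "x \<in> X \<Longrightarrow> bilinear (h x)"
    and h_sym: "x \<in> X \<Longrightarrow> h x u v = h x v u"
    and h_smooth: "smooth_on X (\<lambda>x. h x u v)"
    and h_nondeg: "x \<in> X \<Longrightarrow> (\<And>w. h x u w = 0) \<Longrightarrow> u = 0"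
begin

lemma form: "x \<in> X \<Longrightarrow> nondegenerate_form (h x)"
  using h_bilinear h_sym h_nondeg unfolding nondegenerate_form_def by blast

lemma h_linear1: "x \<in> X \<Longrightarrow> linear (\<lambda>u. h x u v)" and h_linear2: "x \<in> X \<Longrightarrow> linear (h x u)"
  using h_bilinear by (auto simp: bilinear_def)

lemma dh: "x \<in> X \<Longrightarrow> (\<lambda>y. h y u v) differentiable (at x)"
  using smooth_on_differentiable[OF h_smooth] .

lemma ddh: "x \<in> X \<Longrightarrow> (\<lambda>y. fd (\<lambda>y. h y u v) y w) differentiable (at x)"
  using smooth_on_differentiable[OF smooth_on_fd[OF h_smooth]] .

abbreviation \<Gamma> :: "'e \<Rightarrow> 'e \<Rightarrow> 'e \<Rightarrow> 'e" where "\<Gamma> \<equiv> christoffel h"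

definition koszul :: "'e \<Rightarrow> 'e \<Rightarrow> 'e \<Rightarrow> 'e \<Rightarrow> real" where
  "koszul x u v w = fd (\<lambda>y. h y v w) x u + fd (\<lambda>y. h y u w) x v - fd (\<lambda>y. h y u v) x w"

lemma fd_h_linear1: "x \<in> X \<Longrightarrow> linear (\<lambda>u. fd (\<lambda>y. h y u v) x w)"
  by (rule fd_linear_family[OF open_X _ h_linear1 dh])

lemma fd_h_linear2: "x \<in> X \<Longrightarrow> linear (\<lambda>v. fd (\<lambda>y. h y u v) x w)"
  by (rule fd_linear_family[OF open_X _ h_linear2 dh])

lemma fd_h_linear3: "x \<in> X \<Longrightarrow> linear (\<lambda>w. fd (\<lambda>y. h y u v) x w)"
  by (rule linear_fd[OF dh])

lemma fd_h_sym:
  assumes "x \<in> X" shows "fd (\<lambda>y. h y u v) x = fd (\<lambda>y. h y v u) x"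
  by (rule fd_eq_open[OF open_X assms h_sym])

lemma koszul_linear: "x \<in> X \<Longrightarrow> linear (\<lambda>u. koszul x u v w)"
    "x \<in> X \<Longrightarrow> linear (\<lambda>v. koszul x u v w)" "x \<in> X \<Longrightarrow> linear (\<lambda>w. koszul x u v w)"
  unfolding koszul_def
  by (intro linear_compose_add linear_compose_sub fd_h_linear1 fd_h_linear2 fd_h_linear3; assumption)+

lemma christoffel_eq:
  assumes x: "x \<in> X" shows "2 * h x (\<Gamma> x u v) w = koszul x u v w"
proof -
  have "linear (\<lambda>w. (1/2) *\<^sub>R koszul x u v w)"
    using koszul_linear(3)[OF x] linear_compose_scale_right by blast
  from nondegenerate_form.form_representation[OF form[OF x] this]
  have "\<exists>!z. \<forall>w. 2 * h x z w = koszul x u v w"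
    by (simp add: field_simps)
  from theI'[OF this] show ?thesis
    unfolding christoffel_def koszul_def by blast
qed

lemma christoffel_unique:
  assumes "x \<in> X" "\<And>w. 2 * h x z w = koszul x u v w" shows "\<Gamma> x u v = z"
proof (rule nondegenerate_form.form_eqI[OF form[OF assms(1)]])
  show "h x (\<Gamma> x u v) w = h x z w" for w
    using christoffel_eq[OF assms(1), of u v w] assms(2)[of w] by simp
qed

lemma christoffel_sym:
  assumes x: "x \<in> X" shows "\<Gamma> x u v = \<Gamma> x v u"
proof (rule christoffel_unique[OF x])
  show "2 * h x (\<Gamma> x v u) w = koszul x u v w" for w
    using christoffel_eq[OF x, of v u w] fd_h_sym[OF x, of u v] by (simp add: koszul_def)
qed

lemma christoffel_linear2:
  assumes x: "x \<in> X" shows "linear (\<Gamma> x u)"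
proof (intro linearI christoffel_unique[OF x])
  show "2 * h x (\<Gamma> x u a + \<Gamma> x u b) w = koszul x u (a + b) w" for a b w
    using christoffel_eq[OF x, of u a w] christoffel_eq[OF x, of u b w]
    by (simp add: linear_add[OF h_linear1[OF x]] linear_add[OF koszul_linear(2)[OF x]])
  show "2 * h x (r *\<^sub>R \<Gamma> x u a) w = koszul x u (r *\<^sub>R a) w" for r a w
    using christoffel_eq[OF x, of u a w]
    by (simp add: linear_scale[OF h_linear1[OF x]] linear_scale[OF koszul_linear(2)[OF x]])
qed

lemma christoffel_linear1:
  assumes x: "x \<in> X" shows "linear (\<lambda>u. \<Gamma> x u v)"
proof -
  have "(\<lambda>u. \<Gamma> x u v) = \<Gamma> x v" by (rule ext) (rule christoffel_sym[OF x])
  then show ?thesis using christoffel_linear2[OF x] by simp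
qed

text \<open>Half the sum of the Koszul formulas with the last two arguments exchanged.\<close>

lemma christoffel_metric:
  assumes x: "x \<in> X"
  shows "fd (\<lambda>y. h y v w) x u = h x (\<Gamma> x u v) w + h x v (\<Gamma> x u w)"
proof -
  have "h x v (\<Gamma> x u w) = h x (\<Gamma> x u w) v" by (rule h_sym[OF x])
  then show ?thesis
    using christoffel_eq[OF x, of u v w] christoffel_eq[OF x, of u w v] fd_h_sym[OF x, of v w]
    unfolding koszul_def by simp
qed

lemma christoffel_differentiable:
  assumes x: "x \<in> X" shows "(\<lambda>y. \<Gamma> y u v) differentiable (at x)"
proof (rule differentiable_solution[OF open_X x,
      where F="\<lambda>y z. \<Sum>i\<in>Basis. h y z i *\<^sub>R i" and k="\<lambda>y. \<Sum>i\<in>Basis. (koszul y u v i / 2) *\<^sub>R i"])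
  show lin: "linear (\<lambda>z. \<Sum>i\<in>Basis. h y z i *\<^sub>R i)" if "y \<in> X" for y
    by (intro linearI)
      (simp_all add: linear_add[OF h_linear1[OF that]] linear_scale[OF h_linear1[OF that]]
        scaleR_add_left sum.distrib scaleR_sum_right)
  show "(\<lambda>y. \<Sum>i\<in>Basis. h y z i *\<^sub>R i) differentiable (at x)" for z
    by (intro differentiable_sum ballI differentiable_scaleR dh x) auto
  show "(\<lambda>y. \<Sum>i\<in>Basis. (koszul y u v i / 2) *\<^sub>R i) differentiable (at x)"
    unfolding koszul_def
    by (intro differentiable_sum ballI differentiable_scaleR differentiable_divide
        differentiable_add differentiable_diff ddh x) auto
  show "(\<Sum>i\<in>Basis. h y (\<Gamma> y u v) i *\<^sub>R i) = (\<Sum>i\<in>Basis. (koszul y u v i / 2) *\<^sub>R i)" if "y \<in> X" for y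
    using christoffel_eq[OF that, of u v] by (intro sum.cong) (auto simp: field_simps)
  show "inj (\<lambda>z. \<Sum>i\<in>Basis. h x z i *\<^sub>R i)"
  proof (subst linear_injective_0[OF lin[OF x]], intro allI impI)
    fix z assume z: "(\<Sum>i\<in>Basis. h x z i *\<^sub>R i) = 0"
    have i: "h x z i = 0" if "i \<in> Basis" for i
      using arg_cong[OF z, of "\<lambda>w. w \<bullet> i"] that by simp
    show "z = 0"
    proof (rule h_nondeg[OF x])
      fix w
      have "h x z w = h x z (\<Sum>i\<in>Basis. (w \<bullet> i) *\<^sub>R i)" by (simp add: euclidean_representation)
      then show "h x z w = 0"
        by (simp add: linear_sum[OF h_linear2[OF x]] linear_scale[OF h_linear2[OF x]] i)
    qed
  qed
qed

lemma riemann_skew: "riemann h x u v w = - riemann h x v u w"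
  by (simp add: riemann_def)

lemma riemann_linear3:
  assumes x: "x \<in> X" shows "linear (riemann h x u v)"
proof -
  have "linear (\<lambda>w. fd (\<lambda>y. \<Gamma> y v w) x u)" for u v
    by (rule fd_linear_family[OF open_X x christoffel_linear2 christoffel_differentiable[OF x]])
  moreover have "linear (\<lambda>w. \<Gamma> x u (\<Gamma> x v w))" for u v
    using linear_compose[OF christoffel_linear2[OF x] christoffel_linear2[OF x]] by (simp add: o_def)
  ultimately show ?thesis
    unfolding riemann_def by (intro linear_compose_sub linear_compose_add)
qed

lemma riemann_linear1:
  assumes x: "x \<in> X" shows "linear (\<lambda>u. riemann h x u v w)"
proof -
  have "linear (\<lambda>u. fd (\<lambda>y. \<Gamma> y u w) x v)"
    by (rule fd_linear_family[OF open_X x christoffel_linear1 christoffel_differentiable[OF x]])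
  moreover have "linear (\<lambda>u. fd (\<lambda>y. \<Gamma> y v w) x u)"
    by (rule linear_fd[OF christoffel_differentiable[OF x]])
  moreover have "linear (\<lambda>u. \<Gamma> x v (\<Gamma> x u w))"
    using linear_compose[OF christoffel_linear1[OF x] christoffel_linear2[OF x]] by (simp add: o_def)
  ultimately show ?thesis
    unfolding riemann_def by (intro linear_compose_sub linear_compose_add christoffel_linear1[OF x])
qed

lemma fd_christoffel_sym:
  assumes x: "x \<in> X" shows "fd (\<lambda>y. \<Gamma> y u v) x = fd (\<lambda>y. \<Gamma> y v u) x"
  by (rule fd_eq_open[OF open_X x christoffel_sym])

lemma riemann_bianchi:
  assumes x: "x \<in> X" shows "riemann h x u v w + riemann h x v w u + riemann h x w u v = 0"
  unfolding riemann_def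
  using fd_christoffel_sym[OF x, of u v] fd_christoffel_sym[OF x, of u w] fd_christoffel_sym[OF x, of v w]
    christoffel_sym[OF x, of u v] christoffel_sym[OF x, of u w] christoffel_sym[OF x, of v w]
  by simp

text \<open>Differentiating metric compatibility once more expresses the second derivatives of \<open>h v w\<close> by the
  connection; their symmetry is the skew-symmetry of the curvature.\<close>

lemma riemann_metric:
  assumes x: "x \<in> X"
  shows "h x (riemann h x a u v) w = - h x v (riemann h x a u w)"
proof -
  \<comment> \<open>The terms that do not enter the curvature are symmetric in \<open>a\<close> and \<open>u\<close>.\<close>
  have dd: "fd (\<lambda>y. fd (\<lambda>y. h y v w) y u) x a =
      h x (\<Gamma> x a (\<Gamma> x u v)) w + h x (\<Gamma> x u v) (\<Gamma> x a w) + h x (fd (\<lambda>y. \<Gamma> y u v) x a) w +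
      h x (\<Gamma> x a v) (\<Gamma> x u w) + h x v (\<Gamma> x a (\<Gamma> x u w)) + h x v (fd (\<lambda>y. \<Gamma> y u w) x a)" for a u
  proof -
    have "fd (\<lambda>y. fd (\<lambda>y. h y v w) y u) x = fd (\<lambda>y. h y (\<Gamma> y u v) w + h y v (\<Gamma> y u w)) x"
      by (rule fd_eq_open[OF open_X x christoffel_metric])
    moreover have A: "((\<lambda>y. h y (\<Gamma> y u v) w) has_derivative
        (\<lambda>a. fd (\<lambda>y. h y (\<Gamma> x u v) w) x a + h x (fd (\<lambda>y. \<Gamma> y u v) x a) w)) (at x)"
      by (rule linear_family_product_rule[OF open_X x h_linear1 dh[OF x]
            has_derivative_fd[OF christoffel_differentiable[OF x]]])
    moreover have B: "((\<lambda>y. h y v (\<Gamma> y u w)) has_derivative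
        (\<lambda>a. fd (\<lambda>y. h y v (\<Gamma> x u w)) x a + h x v (fd (\<lambda>y. \<Gamma> y u w) x a))) (at x)"
      by (rule linear_family_product_rule[OF open_X x h_linear2 dh[OF x]
            has_derivative_fd[OF christoffel_differentiable[OF x]]])
    ultimately have "fd (\<lambda>y. fd (\<lambda>y. h y v w) y u) x a =
       (fd (\<lambda>y. h y (\<Gamma> x u v) w) x a + h x (fd (\<lambda>y. \<Gamma> y u v) x a) w) +
       (fd (\<lambda>y. h y v (\<Gamma> x u w)) x a + h x v (fd (\<lambda>y. \<Gamma> y u w) x a))"
      using fd_eq[OF has_derivative_add[OF A B]] by simp
    then show ?thesis by (simp add: christoffel_metric[OF x])
  qed
  have "fd (\<lambda>y. fd (\<lambda>y. h y v w) y u) x a = fd (\<lambda>y. fd (\<lambda>y. h y v w) y a) x u"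
    by (rule symmetric_second_derivative[OF h_smooth open_X x])
  then show ?thesis
    unfolding dd riemann_def
    by (simp add: linear_add[OF h_linear1[OF x]] linear_diff[OF h_linear1[OF x]]
        linear_add[OF h_linear2[OF x]] linear_diff[OF h_linear2[OF x]])
qed

lemma curvature_like: "x \<in> X \<Longrightarrow> curvature_like (h x) (riemann h x)"
  by (intro curvature_like.intro form curvature_like_axioms.intro riemann_linear1 riemann_linear3
      riemann_skew riemann_metric riemann_bianchi)

text \<open>The covariant derivative of \<open>T\<close> splits into a symmetric part, which is half the Lie derivative of
  the metric, and a skew part, which is half the exterior derivative of the dual form. The first is
  zero as \<open>T\<close> is Killing, the second as the dual form has constant components. A parallel field is
  annihilated by the curvature.\<close>

lemma riemann_parallel_field:
  assumes x: "x \<in> X" and T: "smooth_on X T"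
    and closed: "\<And>y w. y \<in> X \<Longrightarrow> h y (T y) w = \<tau> w"
    and killing: "\<And>y v w. y \<in> X \<Longrightarrow>
      fd (\<lambda>z. h z v w) y (T y) + h y (fd T y v) w + h y v (fd T y w) = 0"
  shows "riemann h x u v (T x) = 0"
proof -
  have dT: "T differentiable (at y)" if "y \<in> X" for y using smooth_on_differentiable[OF T that] .
  have ddT: "(\<lambda>y. fd T y v) differentiable (at x)" for v
    using smooth_on_differentiable[OF smooth_on_fd[OF T] x] .
  have par: "\<Gamma> y v (T y) = - fd T y v" if y: "y \<in> X" for y v
  proof (rule christoffel_unique[OF y])
    fix w
    have c: "fd (\<lambda>z. h z (T y) w) y v = - h y (fd T y v) w" for v w
    proof -
      have "((\<lambda>z. h z (T z) w) has_derivative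
          (\<lambda>v. fd (\<lambda>z. h z (T y) w) y v + h y (fd T y v) w)) (at y)"
        by (rule linear_family_product_rule[OF open_X y h_linear1 dh[OF y] has_derivative_fd[OF dT[OF y]]])
      moreover have "((\<lambda>z. h z (T z) w) has_derivative (\<lambda>v. 0)) (at y)"
        by (rule has_derivative_transform_within_open[OF has_derivative_const open_X y]) (simp add: closed)
      ultimately have "fd (\<lambda>z. h z (T y) w) y v + h y (fd T y v) w = 0"
        by (rule has_derivative_unique[THEN fun_cong])
      then show ?thesis by simp
    qed
    have "h y (fd T y w) v = h y v (fd T y w)" by (rule h_sym[OF y])
    then show "2 * h y (- fd T y v) w = koszul y v (T y) w"
      unfolding koszul_def fd_h_sym[OF y, of v "T y"] c
      using killing[OF y, of v w] linear_neg[OF h_linear1[OF y]] by simp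
  qed
  have d: "fd (\<lambda>y. \<Gamma> y v (T x)) x u = - \<Gamma> x v (fd T x u) - fd (\<lambda>y. fd T y v) x u" for u v
  proof -
    have "((\<lambda>y. \<Gamma> y v (T y)) has_derivative
        (\<lambda>u. fd (\<lambda>y. \<Gamma> y v (T x)) x u + \<Gamma> x v (fd T x u))) (at x)"
      by (rule linear_family_product_rule[OF open_X x christoffel_linear2
            christoffel_differentiable[OF x] has_derivative_fd[OF dT[OF x]]])
    moreover have "((\<lambda>y. \<Gamma> y v (T y)) has_derivative (\<lambda>u. - fd (\<lambda>y. fd T y v) x u)) (at x)"
      by (rule has_derivative_transform_within_open[OF has_derivative_minus[OF has_derivative_fd[OF ddT]] open_X x])
        (simp add: par)
    ultimately have "fd (\<lambda>y. \<Gamma> y v (T x)) x u + \<Gamma> x v (fd T x u) = - fd (\<lambda>y. fd T y v) x u"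
      by (rule has_derivative_unique[THEN fun_cong])
    then show ?thesis by (simp add: eq_neg_iff_add_eq_0 algebra_simps)
  qed
  have "fd (\<lambda>y. fd T y v) x u = fd (\<lambda>y. fd T y u) x v"
    by (rule symmetric_second_derivative[OF T open_X x])
  then show ?thesis
    unfolding riemann_def d par[OF x] by (simp add: linear_neg[OF christoffel_linear2[OF x]])
qed

theorem flat_if_einstein_with_closed_killing_field:
  assumes x: "x \<in> X" and dim: "DIM('e) = 4" and T: "smooth_on X T"
    and closed: "\<And>y w. y \<in> X \<Longrightarrow> h y (T y) w = \<tau> w" and "\<tau> (T x) \<noteq> 0"
    and killing: "\<And>y v w. y \<in> X \<Longrightarrow>
      fd (\<lambda>z. h z v w) y (T y) + h y (fd T y v) w + h y v (fd T y w) = 0"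
    and einstein: "\<And>v w. ricci h x v w = \<Lambda> * h x v w"
  shows "riemann h x u v w = 0"
proof (rule curvature_like.flat_if_einstein_with_parallel_vector[OF curvature_like[OF x] dim])
  show "riemann h x u v (T x) = 0" for u v
    by (rule riemann_parallel_field[OF x T closed killing])
  show "h x (T x) (T x) \<noteq> 0" using closed[OF x] assms(5) by simp
  show "(\<Sum>i\<in>Basis. riemann h x i v w \<bullet> i) = \<Lambda> * h x v w" for v w
    using einstein by (simp add: ricci_def)
qed

end

section \<open>Charts and tangent vectors\<close>

lemma chart_inv_in: "x \<in> chart_img c \<Longrightarrow> chart_inv c x \<in> fst c"
  by (simp add: chart_inv_def chart_img_def inv_into_into)

lemma chart_chart_inv: "x \<in> chart_img c \<Longrightarrow> snd c (chart_inv c x) = x"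
  by (simp add: chart_inv_def chart_img_def f_inv_into_f)

lemma chart_img_I: "p \<in> fst c \<Longrightarrow> snd c p \<in> chart_img c"
  by (simp add: chart_img_def)

text \<open>The chart axioms on their own: they pass to the product with an open subset of the line by a
  computation with one chart at a time.\<close>

definition smooth_atlas :: "('a, 'e::euclidean_space) mfd \<Rightarrow> bool" where
  "smooth_atlas M \<longleftrightarrow>
     (\<forall>c\<in>atlas M. openin (mtop M) (fst c) \<and> open (chart_img c) \<and>
        homeomorphic_map (subtopology (mtop M) (fst c)) (top_of_set (chart_img c)) (snd c)) \<and>
     (\<Union>c\<in>atlas M. fst c) = points M \<and>
     (\<forall>c\<in>atlas M. \<forall>d\<in>atlas M. smooth_on (snd c ` (fst c \<inter> fst d)) (snd d \<circ> chart_inv c))"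

lemma smooth_manifold_atlas: "smooth_manifold M \<Longrightarrow> smooth_atlas M"
  unfolding smooth_manifold_def smooth_atlas_def by blast

context
  fixes M :: "('a, 'e::euclidean_space) mfd"
  assumes M: "smooth_atlas M"
begin

lemma chart_open: "c \<in> atlas M \<Longrightarrow> open (chart_img c)"
  and chart_dom_open: "c \<in> atlas M \<Longrightarrow> openin (mtop M) (fst c)"
  and chart_homeo: "c \<in> atlas M \<Longrightarrow>
    homeomorphic_map (subtopology (mtop M) (fst c)) (top_of_set (chart_img c)) (snd c)"
  and chart_cover: "p \<in> points M \<Longrightarrow> \<exists>c\<in>atlas M. p \<in> fst c"
  and chart_transition: "c \<in> atlas M \<Longrightarrow> d \<in> atlas M \<Longrightarrow>
    smooth_on (snd c ` (fst c \<inter> fst d)) (snd d \<circ> chart_inv c)"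
  using M unfolding smooth_atlas_def by blast+

lemma chart_dom_points: "c \<in> atlas M \<Longrightarrow> fst c \<subseteq> points M"
  using chart_dom_open openin_subset by blast

lemma chart_inv_chart:
  assumes "c \<in> atlas M" "p \<in> fst c" shows "chart_inv c (snd c p) = p"
proof -
  have "inj_on (snd c) (fst c)"
    using homeomorphic_imp_injective_map[OF chart_homeo[OF assms(1)]] chart_dom_points[OF assms(1)]
    by (simp add: Int_absorb1)
  then show ?thesis using assms(2) by (simp add: chart_inv_def)
qed

lemma chart_image_open:
  assumes c: "c \<in> atlas M" and W: "openin (mtop M) W" shows "open (snd c ` (fst c \<inter> W))"
proof -
  have "openin (subtopology (mtop M) (fst c)) (fst c \<inter> W)"
    using W by (metis Int_commute openin_subtopology)
  then have "openin (top_of_set (chart_img c)) (snd c ` (fst c \<inter> W))"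
    using homeomorphic_imp_open_map[OF chart_homeo[OF c]] by (simp add: open_map_def)
  then show ?thesis using chart_open[OF c] openin_open_trans by blast
qed

lemma chart_preimage_open:
  assumes c: "c \<in> atlas M" and V: "open V" shows "openin (mtop M) {p \<in> fst c. snd c p \<in> V}"
proof -
  have "openin (top_of_set (chart_img c)) (chart_img c \<inter> V)" using V by blast
  from openin_continuous_map_preimage[OF homeomorphic_imp_continuous_map[OF chart_homeo[OF c]] this]
  have "openin (subtopology (mtop M) (fst c)) {p \<in> fst c. snd c p \<in> V}"
    using chart_dom_points[OF c]
    by (simp add: Int_absorb1 chart_img_I cong: conj_cong)
  then show ?thesis using chart_dom_open[OF c] openin_trans_full by blast
qed

text \<open>Smoothness near a point can be tested in a single chart, as the transition maps are smooth.\<close>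

lemma smooth_nearI:
  assumes c: "c \<in> atlas M" "p \<in> fst c" and V: "open V" "snd c p \<in> V"
    and f: "smooth_on V (f \<circ> chart_inv c)"
  shows "smooth_near M p f"
  unfolding smooth_near_def
proof (intro exI[of _ "{q \<in> fst c. snd c q \<in> V}"] conjI ballI)
  let ?W = "{q \<in> fst c. snd c q \<in> V}"
  show W: "openin (mtop M) ?W" by (rule chart_preimage_open[OF c(1) V(1)])
  show "p \<in> ?W" using c V by simp
  fix d assume d: "d \<in> atlas M"
  have o: "open (snd d ` (fst d \<inter> ?W))" by (rule chart_image_open[OF d W])
  have "smooth_on (snd d ` (fst d \<inter> ?W)) (\<lambda>x. (f \<circ> chart_inv c) ((snd c \<circ> chart_inv d) x))"
  proof (rule smooth_on_compose[OF f _ o])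
    show "smooth_on (snd d ` (fst d \<inter> ?W)) (snd c \<circ> chart_inv d)"
      by (rule smooth_on_subset[OF chart_transition[OF d c(1)]]) auto
    show "(snd c \<circ> chart_inv d) ` (snd d ` (fst d \<inter> ?W)) \<subseteq> V"
      using chart_inv_chart[OF d] by auto
  qed
  then show "smooth_on (snd d ` (fst d \<inter> ?W)) (f \<circ> chart_inv d)"
    by (rule smooth_on_cong[OF _ o]) (auto simp: chart_inv_chart[OF d] chart_inv_chart[OF c(1)])
qed

lemma smooth_nearD:
  assumes "smooth_near M p f" and c: "c \<in> atlas M" "p \<in> fst c"
  obtains V where "open V" "snd c p \<in> V" "V \<subseteq> chart_img c" "smooth_on V (f \<circ> chart_inv c)"
proof -
  obtain W where W: "openin (mtop M) W" "p \<in> W" "smooth_on (snd c ` (fst c \<inter> W)) (f \<circ> chart_inv c)"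
    using assms unfolding smooth_near_def by blast
  show thesis
    by (rule that[OF chart_image_open[OF c(1) W(1)] _ _ W(3)]) (use W c in \<open>auto simp: chart_img_def\<close>)
qed

lemma smooth_near_differentiable:
  assumes "smooth_near M p f" "c \<in> atlas M" "p \<in> fst c"
  shows "(f \<circ> chart_inv c) differentiable (at (snd c p))"
  by (rule smooth_nearD[OF assms]) (rule smooth_on_differentiable)

lemma smooth_fun_near:
  assumes "smooth_fun M f" "p \<in> points M" shows "smooth_near M p f"
proof -
  obtain c where c: "c \<in> atlas M" "p \<in> fst c" using chart_cover[OF assms(2)] by blast
  show ?thesis
    by (rule smooth_nearI[OF c chart_open[OF c(1)] chart_img_I[OF c(2)]])
      (use assms(1) c(1) in \<open>simp add: smooth_fun_def\<close>)
qed

lemma coord_vec_tangent: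
  assumes "c \<in> atlas M" "p \<in> fst c" shows "coord_vec M c p u \<in> tangent_space M p"
  using assms unfolding tangent_space_def by blast

lemma velocity_coord_vec:
  assumes c: "c \<in> atlas M" and J: "open J" "t \<in> J" "\<And>s. s \<in> J \<Longrightarrow> \<gamma> s \<in> fst c"
    and d: "((\<lambda>s. snd c (\<gamma> s)) has_derivative (\<lambda>r. r *\<^sub>R w)) (at t)"
  shows "velocity M \<gamma> t = coord_vec M c (\<gamma> t) w"
proof (rule ext)
  fix f
  show "velocity M \<gamma> t f = coord_vec M c (\<gamma> t) w f"
  proof (cases "smooth_near M (\<gamma> t) f")
    case True
    from smooth_near_differentiable[OF True c J(3)[OF J(2)]]
    have df: "((f \<circ> chart_inv c) has_derivative fd (f \<circ> chart_inv c) (snd c (\<gamma> t))) (at (snd c (\<gamma> t)))"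
      by (rule has_derivative_fd)
    have "((\<lambda>s. (f \<circ> chart_inv c) (snd c (\<gamma> s))) has_derivative
        (\<lambda>r. fd (f \<circ> chart_inv c) (snd c (\<gamma> t)) (r *\<^sub>R w))) (at t)"
      by (rule has_derivative_compose[OF d df])
    then have "((f \<circ> \<gamma>) has_derivative (\<lambda>r. fd (f \<circ> chart_inv c) (snd c (\<gamma> t)) (r *\<^sub>R w))) (at t)"
      by (rule has_derivative_transform_within_open[OF _ J(1,2)]) (simp add: chart_inv_chart[OF c J(3)])
    then have "((f \<circ> \<gamma>) has_real_derivative fd (f \<circ> chart_inv c) (snd c (\<gamma> t)) w) (at t)"
      by (rule has_derivative_imp_has_field_derivative)
        (simp add: linear_scale[OF has_derivative_linear[OF df]])
    then show ?thesis using True by (simp add: velocity_def coord_vec_def DERIV_imp_deriv)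
  qed (simp add: velocity_def coord_vec_def)
qed

end

text \<open>The differential acts on components by the derivative of the local representative. The first
  conclusion is needed because tangent vectors are only meaningful on functions that are smooth near
  their base point.\<close>

lemma differential_coord_vec:
  assumes M: "smooth_atlas M" and N: "smooth_atlas N"
    and c: "c \<in> atlas M" "p \<in> fst c" and d: "d \<in> atlas N"
    and V: "open V" "snd c p \<in> V" "V \<subseteq> chart_img c"
    and F: "\<And>x. x \<in> V \<Longrightarrow> F (chart_inv c x) \<in> fst d" "\<And>x. x \<in> V \<Longrightarrow> snd d (F (chart_inv c x)) = \<phi> x"
    and \<phi>: "smooth_on V \<phi>"
  shows smooth_near_compose: "smooth_near N (F p) f \<Longrightarrow> smooth_near M p (f \<circ> F)"
    and "differential N F p (coord_vec M c p u) = coord_vec N d (F p) (fd \<phi> (snd c p) u)"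
proof -
  have p: "chart_inv c (snd c p) = p" by (rule chart_inv_chart[OF M c])
  have Fp: "F p \<in> fst d" "snd d (F p) = \<phi> (snd c p)" using F[OF V(2)] p by simp_all
  have eq: "(f \<circ> F \<circ> chart_inv c) x = (f \<circ> chart_inv d) (\<phi> x)" if "x \<in> V" for x and f :: "_ \<Rightarrow> real"
    by (simp flip: F(2)[OF that] add: chart_inv_chart[OF N d F(1)[OF that]])
  show near: "smooth_near M p (f \<circ> F)" if f: "smooth_near N (F p) f" for f
  proof -
    obtain V' where V': "open V'" "snd d (F p) \<in> V'" "smooth_on V' (f \<circ> chart_inv d)"
      by (rule smooth_nearD[OF N f d Fp(1)])
    define W where "W = V \<inter> \<phi> -` V'"
    have W: "open W"
      unfolding W_def by (rule continuous_open_preimage[OF smooth_on_continuous[OF \<phi>] V(1) V'(1)])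
    show ?thesis
    proof (rule smooth_nearI[OF M c W])
      show "snd c p \<in> W" using V(2) V'(2) Fp(2) by (simp add: W_def)
      have "smooth_on W (\<lambda>x. (f \<circ> chart_inv d) (\<phi> x))"
        by (rule smooth_on_compose[OF V'(3) smooth_on_subset[OF \<phi>] W]) (auto simp: W_def)
      then show "smooth_on W ((f \<circ> F) \<circ> chart_inv c)"
        by (rule smooth_on_cong[OF _ W]) (unfold W_def, elim IntE, rule eq[symmetric])
    qed
  qed
  show "differential N F p (coord_vec M c p u) = coord_vec N d (F p) (fd \<phi> (snd c p) u)"
  proof (rule ext)
    fix f
    show "differential N F p (coord_vec M c p u) f = coord_vec N d (F p) (fd \<phi> (snd c p) u) f"
    proof (cases "smooth_near N (F p) f")
      case True
      have 1: "(\<phi> has_derivative fd \<phi> (snd c p)) (at (snd c p))"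
        by (rule has_derivative_fd[OF smooth_on_differentiable[OF \<phi> V(2)]])
      have 2: "((f \<circ> chart_inv d) has_derivative fd (f \<circ> chart_inv d) (\<phi> (snd c p))) (at (\<phi> (snd c p)))"
        using has_derivative_fd[OF smooth_near_differentiable[OF N True d Fp(1)]] unfolding Fp(2) .
      have "((\<lambda>x. (f \<circ> chart_inv d) (\<phi> x)) has_derivative
          (\<lambda>u. fd (f \<circ> chart_inv d) (\<phi> (snd c p)) (fd \<phi> (snd c p) u))) (at (snd c p))"
        by (rule has_derivative_compose[OF 1 2])
      then have "((f \<circ> F \<circ> chart_inv c) has_derivative
          (\<lambda>u. fd (f \<circ> chart_inv d) (\<phi> (snd c p)) (fd \<phi> (snd c p) u))) (at (snd c p))"
        by (rule has_derivative_transform_within_open[OF _ V(1,2)]) (rule eq[symmetric])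
      from fd_eq[OF this] show ?thesis
        using True near[OF True] Fp(2) by (simp add: differential_def coord_vec_def)
    qed (simp add: differential_def coord_vec_def)
  qed
qed

text \<open>The transformation law for components, obtained from the identity map in two charts.\<close>

lemma coord_vec_change:
  assumes M: "smooth_atlas M" and c: "c \<in> atlas M" "p \<in> fst c" and d: "d \<in> atlas M" "p \<in> fst d"
  shows "coord_vec M c p u = coord_vec M d p (fd (snd d \<circ> chart_inv c) (snd c p) u)"
proof -
  have "differential M (\<lambda>q. q) p (coord_vec M c p u) = coord_vec M d p (fd (snd d \<circ> chart_inv c) (snd c p) u)"
  proof (rule differential_coord_vec(2)[OF M M c d(1) chart_image_open[OF M c(1) chart_dom_open[OF M d(1)]]])
    show "smooth_on (snd c ` (fst c \<inter> fst d)) (snd d \<circ> chart_inv c)"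
      by (rule chart_transition[OF M c(1) d(1)])
  qed (use c d chart_inv_chart[OF M c(1)] in \<open>auto simp: chart_img_def\<close>)
  moreover have "differential M (\<lambda>q. q) p (coord_vec M c p u) = coord_vec M c p u"
    by (auto simp: differential_def coord_vec_def fun_eq_iff o_def)
  ultimately show ?thesis by simp
qed

lemma tangent_space_chart:
  assumes "smooth_atlas M" "c \<in> atlas M" "p \<in> fst c" "v \<in> tangent_space M p"
  obtains u where "v = coord_vec M c p u"
  using assms(4) coord_vec_change[OF assms(1) _ _ assms(2,3)] unfolding tangent_space_def by blast

lemma smooth_map_local:
  assumes F: "smooth_map M N F" and M: "smooth_atlas M" and N: "smooth_atlas N"
    and c: "c \<in> atlas M" and d: "d \<in> atlas N"
  shows "open (snd c ` (fst c \<inter> F -` fst d))"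
    and "smooth_on (snd c ` (fst c \<inter> F -` fst d)) (snd d \<circ> F \<circ> chart_inv c)"
proof -
  have "openin (mtop M) {p \<in> points M. F p \<in> fst d}"
    using F chart_dom_open[OF N d] openin_continuous_map_preimage unfolding smooth_map_def by blast
  moreover have "fst c \<inter> {p \<in> points M. F p \<in> fst d} = fst c \<inter> F -` fst d"
    using chart_dom_points[OF M c] by auto
  ultimately show "open (snd c ` (fst c \<inter> F -` fst d))" using chart_image_open[OF M c] by metis
  show "smooth_on (snd c ` (fst c \<inter> F -` fst d)) (snd d \<circ> F \<circ> chart_inv c)"
    using F c d unfolding smooth_map_def by blast
qed

section \<open>Product with an open subset of the line\<close>

definition line_chart :: "real set \<Rightarrow> ('a, 'e) chart \<Rightarrow> ('a \<times> real, 'e \<times> real) chart" where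
  "line_chart I c = (fst c \<times> I, map_prod (snd c) id)"

lemma atlas_prod_line: "atlas (prod_mfd S (line_mfd I)) = line_chart I ` atlas S"
  by (auto simp: prod_mfd_def line_mfd_def line_chart_def image_def)

lemma fst_line_chart [simp]: "fst (line_chart I c) = fst c \<times> I"
  and snd_line_chart [simp]: "snd (line_chart I c) (s, t) = (snd c s, t)"
  by (simp_all add: line_chart_def)

lemma chart_img_line_chart: "chart_img (line_chart I c) = chart_img c \<times> I"
  by (auto simp: chart_img_def line_chart_def image_iff)

lemma points_prod_line: "points (prod_mfd S (line_mfd I)) = points S \<times> I"
  by (simp add: prod_mfd_def line_mfd_def)

lemma chart_inv_line_chart:
  assumes S: "smooth_atlas S" "c \<in> atlas S" and x: "x \<in> chart_img c" "t \<in> I"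
  shows "chart_inv (line_chart I c) (x, t) = (chart_inv c x, t)"
proof -
  obtain s where s: "s \<in> fst c" "x = snd c s" using x(1) by (auto simp: chart_img_def)
  have "inj_on (snd (line_chart I c)) (fst (line_chart I c))"
    by (rule inj_on_inverseI[where g="map_prod (chart_inv c) id"])
      (auto simp: chart_inv_chart[OF S])
  then have "inv_into (fst (line_chart I c)) (snd (line_chart I c)) (snd (line_chart I c) (s, t)) = (s, t)"
    using s x by (intro inv_into_f_f) auto
  then show ?thesis using chart_inv_chart[OF S s(1)] s(2) by (simp add: chart_inv_def)
qed

lemma smooth_atlas_prod_line:
  assumes S: "smooth_atlas S" and I: "open I" shows "smooth_atlas (prod_mfd S (line_mfd I))"
  unfolding smooth_atlas_def atlas_prod_line
proof (intro conjI ballI; (elim imageE)?)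
  fix c' c assume c': "c' = line_chart I c" and c: "c \<in> atlas S"
  show "openin (mtop (prod_mfd S (line_mfd I))) (fst c')"
    unfolding c' using chart_dom_open[OF S c] by (simp add: prod_mfd_def line_mfd_def openin_prod_Times_iff)
  show "open (chart_img c')"
    unfolding c' chart_img_line_chart using chart_open[OF S c] I by (rule open_Times)
  obtain k where k: "homeomorphic_maps (subtopology (mtop S) (fst c)) (top_of_set (chart_img c)) (snd c) k"
    using chart_homeo[OF S c] homeomorphic_map_maps by blast
  have "homeomorphic_maps (top_of_set I) (top_of_set I) id id" by (simp add: homeomorphic_maps_id)
  then have "homeomorphic_maps (prod_topology (subtopology (mtop S) (fst c)) (top_of_set I))
     (prod_topology (top_of_set (chart_img c)) (top_of_set I)) (\<lambda>(x, y). (snd c x, id y)) (\<lambda>(x, y). (k x, id y))"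
    using k unfolding homeomorphic_maps_prod by blast
  then have "homeomorphic_map (prod_topology (subtopology (mtop S) (fst c)) (top_of_set I))
     (prod_topology (top_of_set (chart_img c)) (top_of_set I)) (\<lambda>(x, y). (snd c x, id y))"
    using homeomorphic_map_maps by blast
  moreover have "subtopology (mtop (prod_mfd S (line_mfd I))) (fst c \<times> I)
      = prod_topology (subtopology (mtop S) (fst c)) (top_of_set I)"
    by (simp add: prod_mfd_def line_mfd_def subtopology_Times[symmetric] subtopology_subtopology)
      (simp add: subtopology_Times subtopology_subtopology)
  moreover have "snd (line_chart I c) = (\<lambda>(x, y). (snd c x, id y))"
    by (auto simp: line_chart_def)
  ultimately show "homeomorphic_map (subtopology (mtop (prod_mfd S (line_mfd I))) (fst c'))
      (top_of_set (chart_img c')) (snd c')"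
    unfolding c' chart_img_line_chart fst_line_chart by (simp add: chart_img_line_chart)
next
  show "(\<Union>c\<in>line_chart I ` atlas S. fst c) = points (prod_mfd S (line_mfd I))"
    using S unfolding points_prod_line smooth_atlas_def by auto
next
  fix c' d' c d assume c': "c' = line_chart I c" and c: "c \<in> atlas S"
    and d': "d' = line_chart I d" and d: "d \<in> atlas S"
  have eq: "snd c' ` (fst c' \<inter> fst d') = (snd c ` (fst c \<inter> fst d)) \<times> I"
    unfolding c' d' line_chart_def by force
  have o: "open (snd c ` (fst c \<inter> fst d))" by (rule chart_image_open[OF S c chart_dom_open[OF S d]])
  then have o': "open ((snd c ` (fst c \<inter> fst d)) \<times> I)" using I by (rule open_Times)
  show "smooth_on (snd c' ` (fst c' \<inter> fst d')) (snd d' \<circ> chart_inv c')"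
    unfolding eq
  proof (rule smooth_on_cong[OF _ o'])
    show "smooth_on ((snd c ` (fst c \<inter> fst d)) \<times> I) (\<lambda>y. ((snd d \<circ> chart_inv c) (fst y), snd y))"
      by (intro smooth_on_Pair smooth_on_compose[OF chart_transition[OF S c d]] o'
          smooth_on_bounded_linear bounded_linear_fst bounded_linear_snd) auto
    fix y assume y: "y \<in> (snd c ` (fst c \<inter> fst d)) \<times> I"
    then have "fst y \<in> chart_img c" "snd y \<in> I" by (auto simp: chart_img_def)
    then have "chart_inv c' y = (chart_inv c (fst y), snd y)"
      unfolding c' using chart_inv_line_chart[OF S c, of "fst y" "snd y" I] by simp
    then show "((snd d \<circ> chart_inv c) (fst y), snd y) = (snd d' \<circ> chart_inv c') y"
      unfolding d' by simp
  qed
qed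

section \<open>A Kerr structure in a chart\<close>

locale kerr_bundle_chart =
  fixes N :: "('n, 'en::euclidean_space) mfd" and J :: "'n \<Rightarrow> 'n tvec \<Rightarrow> 'n tvec"
    and g :: "'n \<Rightarrow> 'n tvec \<Rightarrow> 'n tvec \<Rightarrow> real" and S :: "('s, 'es::euclidean_space) mfd"
    and act :: "'s \<Rightarrow> real \<Rightarrow> 's" and \<pi> :: "'s \<Rightarrow> 'n" and \<theta> :: "'s \<Rightarrow> 's tvec \<Rightarrow> real"
    and c :: "('s, 'es) chart"
  assumes kerr: "kerr_structure N J g S act \<pi> \<theta>" and c: "c \<in> atlas S"
begin

lemma S: "smooth_atlas S" and N: "smooth_atlas N"
  using kerr by (simp_all add: kerr_structure_def principal_line_bundle_def smooth_manifold_atlas)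

lemma \<pi>_smooth: "smooth_map S N \<pi>" and act_0: "s \<in> points S \<Longrightarrow> act s 0 = s"
  and act_smooth: "smooth_map (prod_mfd S (line_mfd UNIV)) S (\<lambda>(s, t). act s t)"
  using kerr by (simp_all add: kerr_structure_def principal_line_bundle_def)

abbreviation X :: "'es set" where "X \<equiv> chart_img c"
abbreviation pt :: "'es \<Rightarrow> 's" where "pt \<equiv> chart_inv c"

lemma X_open: "open X" by (rule chart_open[OF S c])

lemma pt_in: "x \<in> X \<Longrightarrow> pt x \<in> fst c" and chart_pt: "x \<in> X \<Longrightarrow> snd c (pt x) = x"
  by (simp_all add: chart_inv_in chart_chart_inv)

lemma pt_points: "x \<in> X \<Longrightarrow> pt x \<in> points S"
  using pt_in chart_dom_points[OF S c] by blast

subsection \<open>Fundamental field of the action\<close>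

text \<open>The action of the real line as a map between open subsets of model spaces.\<close>

definition flow :: "'es \<times> real \<Rightarrow> 'es" where
  "flow = snd c \<circ> (\<lambda>(s, t). act s t) \<circ> chart_inv (line_chart UNIV c)"

definition flow_dom :: "('es \<times> real) set" where
  "flow_dom = snd (line_chart UNIV c) ` (fst (line_chart UNIV c) \<inter> (\<lambda>(s, t). act s t) -` fst c)"

lemma flow_dom_open: "open flow_dom" and flow_smooth: "smooth_on flow_dom flow"
  using smooth_map_local[OF act_smooth smooth_atlas_prod_line[OF S open_UNIV] S, of "line_chart UNIV c" c] c
  by (simp_all add: atlas_prod_line flow_dom_def flow_def)

lemma flow_eq: "x \<in> X \<Longrightarrow> flow (x, t) = snd c (act (pt x) t)"
  by (simp add: flow_def chart_inv_line_chart[OF S c])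

lemma flow_dom_iff:
  assumes x: "x \<in> X" shows "(x, t) \<in> flow_dom \<longleftrightarrow> act (pt x) t \<in> fst c"
proof
  assume "(x, t) \<in> flow_dom"
  then obtain s where "s \<in> fst c" "act s t \<in> fst c" "x = snd c s" by (auto simp: flow_dom_def)
  then show "act (pt x) t \<in> fst c" using chart_inv_chart[OF S c] by simp
next
  assume "act (pt x) t \<in> fst c"
  then have "(pt x, t) \<in> fst (line_chart UNIV c) \<inter> (\<lambda>(s, t). act s t) -` fst c"
    using pt_in[OF x] by simp
  then have "snd (line_chart UNIV c) (pt x, t) \<in> flow_dom" unfolding flow_dom_def by (rule imageI)
  then show "(x, t) \<in> flow_dom" by (simp add: chart_pt[OF x])
qed

lemma flow_dom_0: "x \<in> X \<Longrightarrow> (x, 0) \<in> flow_dom"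
  by (simp add: flow_dom_iff act_0 pt_points pt_in)

lemma flow_0: "x \<in> X \<Longrightarrow> flow (x, 0) = x"
  by (simp add: flow_eq act_0 pt_points chart_pt)

text \<open>The components of the fundamental vertical field.\<close>

definition Z :: "'es \<Rightarrow> 'es" where "Z x = fd flow (x, 0) (0, 1)"

lemma Z_smooth: "smooth_on X Z"
proof -
  have "smooth_on X (\<lambda>x. (\<lambda>y. fd flow y (0, 1)) (x, 0))"
    by (rule smooth_on_compose[OF smooth_on_fd[OF flow_smooth] _ X_open])
      (auto intro: flow_dom_0
        smooth_on_bounded_linear[OF bounded_linear_Pair[OF bounded_linear_ident bounded_linear_zero]])
  then show ?thesis by (simp add: Z_def[abs_def])
qed

lemma dZ: "x \<in> X \<Longrightarrow> (Z has_derivative fd Z x) (at x)"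
  by (rule has_derivative_fd[OF smooth_on_differentiable[OF Z_smooth]])

lemma orbit_derivative:
  assumes x: "x \<in> X"
  shows "((\<lambda>t. flow (x, t)) has_derivative (\<lambda>r. r *\<^sub>R Z x)) (at 0)"
proof -
  have d: "(flow has_derivative fd flow (x, 0)) (at (x, 0))"
    by (rule has_derivative_fd[OF smooth_on_differentiable[OF flow_smooth flow_dom_0[OF x]]])
  have "((\<lambda>t. (x, t)) has_derivative (\<lambda>r. (0, r))) (at 0)"
    by (auto intro!: derivative_eq_intros)
  from has_derivative_compose[OF this d]
  have "((\<lambda>t. flow (x, t)) has_derivative (\<lambda>r. fd flow (x, 0) (0, r))) (at 0)" .
  moreover have "fd flow (x, 0) (0, r) = r *\<^sub>R Z x" for r
    using linear_scale[OF has_derivative_linear[OF d], of r "(0, 1)"] by (simp add: Z_def)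
  ultimately show ?thesis by simp
qed

lemma orbit_open:
  assumes "open Y" shows "open {t. (x, t) \<in> Y}"
proof -
  have "open ((\<lambda>t. (x, t)) -` Y)" using assms by (intro open_vimage continuous_intros)
  then show ?thesis by (simp add: vimage_def)
qed

lemma velocity_act:
  assumes x: "x \<in> X" shows "velocity S (act (pt x)) 0 = coord_vec S c (pt x) (Z x)"
proof -
  have "velocity S (act (pt x)) 0 = coord_vec S c (act (pt x) 0) (Z x)"
  proof (rule velocity_coord_vec[OF S c orbit_open[OF flow_dom_open, of x]])
    show "((\<lambda>t. snd c (act (pt x) t)) has_derivative (\<lambda>r. r *\<^sub>R Z x)) (at 0)"
      using orbit_derivative[OF x] by (simp add: flow_eq[OF x])
  qed (use flow_dom_0[OF x] in \<open>simp_all add: flow_dom_iff[OF x]\<close>)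
  then show ?thesis by (simp add: act_0[OF pt_points[OF x]])
qed

subsection \<open>Projection to the base\<close>

definition base_dom :: "('n, 'en) chart \<Rightarrow> 'es set" where
  "base_dom d = snd c ` (fst c \<inter> \<pi> -` fst d)"

definition base_rep :: "('n, 'en) chart \<Rightarrow> 'es \<Rightarrow> 'en" where
  "base_rep d = snd d \<circ> \<pi> \<circ> pt"

lemma base_dom_open: "d \<in> atlas N \<Longrightarrow> open (base_dom d)"
  and base_rep_smooth: "d \<in> atlas N \<Longrightarrow> smooth_on (base_dom d) (base_rep d)"
  using smooth_map_local[OF \<pi>_smooth S N c] by (simp_all add: base_dom_def base_rep_def)

lemma base_dom_iff: "x \<in> base_dom d \<longleftrightarrow> x \<in> X \<and> \<pi> (pt x) \<in> fst d"
proof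
  assume "x \<in> base_dom d"
  then obtain s where "s \<in> fst c" "\<pi> s \<in> fst d" "x = snd c s" by (auto simp: base_dom_def)
  then show "x \<in> X \<and> \<pi> (pt x) \<in> fst d" using chart_inv_chart[OF S c] by (auto simp: chart_img_def)
next
  assume "x \<in> X \<and> \<pi> (pt x) \<in> fst d"
  then show "x \<in> base_dom d" using pt_in chart_pt unfolding base_dom_def by force
qed

lemma \<pi>_points: "x \<in> X \<Longrightarrow> \<pi> (pt x) \<in> points N"
  using \<pi>_smooth pt_points unfolding smooth_map_def continuous_map_def by blast

lemma base_chart_exists: "x \<in> X \<Longrightarrow> \<exists>d\<in>atlas N. x \<in> base_dom d"
  using chart_cover[OF N \<pi>_points] by (auto simp: base_dom_iff)

lemma d_base_rep: "d \<in> atlas N \<Longrightarrow> x \<in> base_dom d \<Longrightarrow> (base_rep d has_derivative fd (base_rep d) x) (at x)"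
  by (rule has_derivative_fd[OF smooth_on_differentiable[OF base_rep_smooth]])

lemma differential_\<pi>:
  assumes d: "d \<in> atlas N" and x: "x \<in> base_dom d"
  shows "differential N \<pi> (pt x) (coord_vec S c (pt x) u) = coord_vec N d (\<pi> (pt x)) (fd (base_rep d) x u)"
proof -
  have xX: "x \<in> X" using x by (simp add: base_dom_iff)
  have "differential N \<pi> (pt x) (coord_vec S c (pt x) u)
      = coord_vec N d (\<pi> (pt x)) (fd (base_rep d) (snd c (pt x)) u)"
    by (rule differential_coord_vec(2)[OF S N c pt_in[OF xX] d base_dom_open[OF d] _ _ _ _ base_rep_smooth[OF d]])
      (use x in \<open>auto simp: base_dom_iff chart_pt base_rep_def\<close>)
  then show ?thesis by (simp add: chart_pt[OF xX])
qed

lemma smooth_near_\<pi>: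
  assumes x: "x \<in> X" and f: "smooth_near N (\<pi> (pt x)) f" shows "smooth_near S (pt x) (f \<circ> \<pi>)"
proof -
  obtain d where d: "d \<in> atlas N" "x \<in> base_dom d" using base_chart_exists[OF x] by blast
  show ?thesis
    by (rule smooth_near_compose[where F=\<pi> and \<phi>="base_rep d",
          OF S N c pt_in[OF x] d(1) base_dom_open[OF d(1)] _ _ _ _ base_rep_smooth[OF d(1)] f])
      (use d(2) in \<open>auto simp: base_dom_iff chart_pt base_rep_def\<close>)
qed

text \<open>The projection is constant along orbits: a local trivialization sends nearby points of an orbit
  to points with the same first component.\<close>

lemma base_rep_Z:
  assumes d: "d \<in> atlas N" and x: "x \<in> base_dom d"
  shows "fd (base_rep d) x (Z x) = 0"
proof -
  have xX: "x \<in> X" using x by (simp add: base_dom_iff)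
  from kerr have "principal_line_bundle N S act \<pi>" by (simp add: kerr_structure_def)
  then have "\<exists>U \<Phi>. openin (mtop N) U \<and> \<pi> (pt x) \<in> U \<and> (\<forall>s\<in>points S \<inter> \<pi> -` U.
      fst (\<Phi> s) = \<pi> s \<and> (\<forall>t. \<Phi> (act s t) = (fst (\<Phi> s), snd (\<Phi> s) + t)))"
    using \<pi>_points[OF xX] unfolding principal_line_bundle_def
    by (elim conjE) (drule (1) bspec, elim exE conjE, intro exI conjI; assumption)
  then obtain U \<Phi> where U: "openin (mtop N) U" "\<pi> (pt x) \<in> U"
    and triv: "\<forall>s\<in>points S \<inter> \<pi> -` U. fst (\<Phi> s) = \<pi> s \<and>
           (\<forall>t. \<Phi> (act s t) = (fst (\<Phi> s), snd (\<Phi> s) + t))" by (elim exE conjE)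
  have \<Phi>: "fst (\<Phi> s) = \<pi> s" "\<Phi> (act s t) = (fst (\<Phi> s), snd (\<Phi> s) + t)"
    if "s \<in> points S" "\<pi> s \<in> U" for s t
    using triv that by simp_all
  \<comment> \<open>Small times, for which the orbit stays in the domain of the trivialization.\<close>
  define V where "V = snd c ` (fst c \<inter> {s \<in> points S. \<pi> s \<in> U})"
  have V: "open V"
    unfolding V_def using \<pi>_smooth U(1) openin_continuous_map_preimage
    by (intro chart_image_open[OF S c]) (auto simp: smooth_map_def)
  define W where "W = flow_dom \<inter> flow -` V"
  have W: "open W"
    unfolding W_def by (rule continuous_open_preimage[OF smooth_on_continuous[OF flow_smooth] flow_dom_open V])
  have "pt x \<in> fst c \<inter> {s \<in> points S. \<pi> s \<in> U}" using pt_in[OF xX] pt_points[OF xX] U(2) by simp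
  then have "snd c (pt x) \<in> V" unfolding V_def by (rule imageI)
  then have x0: "(x, 0) \<in> W" by (simp add: W_def flow_dom_0[OF xX] flow_0[OF xX] chart_pt[OF xX])
  have const: "base_rep d (flow (x, t)) = base_rep d x" if t: "(x, t) \<in> W" for t
  proof -
    let ?q = "act (pt x) t"
    have q: "?q \<in> fst c" using t by (simp add: W_def flow_dom_iff[OF xX])
    obtain s where s: "s \<in> fst c" "\<pi> s \<in> U" "snd c ?q = snd c s" "s \<in> points S"
      using t by (auto simp: W_def V_def flow_eq[OF xX])
    have qs: "?q = s"
      using arg_cong[OF s(3), of "chart_inv c"]
      unfolding chart_inv_chart[OF S c q] chart_inv_chart[OF S c s(1)] .
    have "\<pi> ?q = fst (\<Phi> ?q)" unfolding qs by (rule \<Phi>(1)[OF s(4,2), symmetric])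
    also have "\<dots> = \<pi> (pt x)" using \<Phi>[OF pt_points[OF xX] U(2)] by simp
    finally show ?thesis by (simp add: base_rep_def flow_eq[OF xX] chart_inv_chart[OF S c q])
  qed
  have "((\<lambda>t. base_rep d (flow (x, t))) has_derivative (\<lambda>r. fd (base_rep d) x (r *\<^sub>R Z x))) (at 0)"
    using has_derivative_compose[OF orbit_derivative[OF xX], of "base_rep d" "fd (base_rep d) x"]
      d_base_rep[OF d x] by (simp add: flow_0[OF xX])
  moreover have "((\<lambda>t. base_rep d (flow (x, t))) has_derivative (\<lambda>r. 0)) (at 0)"
    by (rule has_derivative_transform_within_open[OF has_derivative_const orbit_open[OF W]])
      (use x0 const in auto)
  ultimately have "fd (base_rep d) x (1 *\<^sub>R Z x) = 0"
    by (rule has_derivative_unique[THEN fun_cong])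
  then show ?thesis by simp
qed

subsection \<open>Connection form\<close>

abbreviation th :: "'es \<Rightarrow> 'es \<Rightarrow> real" where "th \<equiv> comp1 S c \<theta>"

lemma th_linear: "x \<in> X \<Longrightarrow> linear (th x)" and th_smooth: "smooth_on X (\<lambda>x. th x u)"
  using kerr c by (simp_all add: kerr_structure_def connection_form_def one_form_def)

lemma dth: "x \<in> X \<Longrightarrow> (\<lambda>x. th x u) differentiable (at x)"
  by (rule smooth_on_differentiable[OF th_smooth])

lemma th_Z:
  assumes x: "x \<in> X" shows "th x (Z x) = 1"
proof -
  have "\<theta> (pt x) (velocity S (act (pt x)) 0) = 1"
    using kerr pt_points[OF x] by (simp add: kerr_structure_def connection_form_def)
  then show ?thesis by (simp add: comp1_def Let_def velocity_act[OF x])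
qed

lemma metric_base: "d \<in> atlas N \<Longrightarrow> y \<in> chart_img d \<Longrightarrow> bilinear (comp2 N d g y)"
  and metric_base_smooth: "d \<in> atlas N \<Longrightarrow> smooth_on (chart_img d) (\<lambda>y. comp2 N d g y u v)"
  using kerr by (simp_all add: kerr_structure_def kaehler_manifold_def riemannian_metric_def sym_tensor_def)

lemma base_rep_img:
  assumes "d \<in> atlas N" "x \<in> base_dom d"
  shows "base_rep d x \<in> chart_img d" "chart_inv d (base_rep d x) = \<pi> (pt x)"
  using assms chart_inv_chart[OF N] by (auto simp: base_dom_iff base_rep_def chart_img_def)

text \<open>The fundamental field is in the kernel of the pullback of the Kaehler form. Placing it in the second
  slot avoids applying \<open>J\<close> to the zero vector.\<close>

lemma dth_Z:
  assumes x: "x \<in> X" shows "fd (\<lambda>y. th y (Z x)) x v = fd (\<lambda>y. th y v) x (Z x)"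
proof -
  obtain d where d: "d \<in> atlas N" "x \<in> base_dom d" using base_chart_exists[OF x] by blast
  have \<pi>d: "\<pi> (pt x) \<in> fst d" using d(2) by (simp add: base_dom_iff)
  let ?v = "differential N \<pi> (pt x) (coord_vec S c (pt x) v)"
  have "?v \<in> tangent_space N (\<pi> (pt x))"
    unfolding differential_\<pi>[OF d] by (rule coord_vec_tangent[OF N d(1) \<pi>d])
  then have "J (\<pi> (pt x)) ?v \<in> tangent_space N (\<pi> (pt x))"
    using kerr \<pi>_points[OF x]
    by (auto simp: kerr_structure_def kaehler_manifold_def complex_structure_def endo_field_def)
  then obtain w where w: "J (\<pi> (pt x)) ?v = coord_vec N d (\<pi> (pt x)) w"
    by (rule tangent_space_chart[OF N d(1) \<pi>d])
  have "ext_deriv1 th x v (Z x) =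
      kaehler_form J g (\<pi> (pt x)) ?v (differential N \<pi> (pt x) (coord_vec S c (pt x) (Z x)))"
    using kerr c x by (simp add: kerr_structure_def comp2_def Let_def)
  also have "\<dots> = comp2 N d g (base_rep d x) w 0"
    by (simp add: kaehler_form_def w differential_\<pi>[OF d, of "Z x"] base_rep_Z[OF d] comp2_def
        Let_def base_rep_img[OF d])
  also have "\<dots> = 0"
    using bilinear_rzero[OF metric_base[OF d(1) base_rep_img(1)[OF d]]] .
  finally show ?thesis by (simp add: ext_deriv1_def)
qed

text \<open>Cartan's formula: \<open>\<theta>(Z)\<close> is constant and \<open>d\<theta>(Z, \<cdot>) = 0\<close>, so the Lie derivative of \<open>\<theta>\<close> along \<open>Z\<close> is zero.\<close>

lemma th_lie:
  assumes x: "x \<in> X" shows "fd (\<lambda>y. th y v) x (Z x) + th x (fd Z x v) = 0"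
proof -
  have "((\<lambda>y. th y (Z y)) has_derivative (\<lambda>v. fd (\<lambda>y. th y (Z x)) x v + th x (fd Z x v))) (at x)"
    by (rule linear_family_product_rule[OF X_open x th_linear dth[OF x] dZ[OF x]])
  moreover have "((\<lambda>y. th y (Z y)) has_derivative (\<lambda>v. 0)) (at x)"
    by (rule has_derivative_transform_within_open[OF has_derivative_const X_open x]) (simp add: th_Z)
  ultimately have "fd (\<lambda>y. th y (Z x)) x v + th x (fd Z x v) = 0"
    by (rule has_derivative_unique[THEN fun_cong])
  then show ?thesis by (simp add: dth_Z[OF x])
qed

subsection \<open>Pullback of the base metric\<close>

text \<open>The components of the pullback of the base metric to the bundle.\<close>

definition G :: "'es \<Rightarrow> 'es \<Rightarrow> 'es \<Rightarrow> real" where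
  "G x u v = g (\<pi> (pt x)) (differential N \<pi> (pt x) (coord_vec S c (pt x) u))
     (differential N \<pi> (pt x) (coord_vec S c (pt x) v))"

lemma G_eq:
  assumes "d \<in> atlas N" "x \<in> base_dom d"
  shows "G x u v = comp2 N d g (base_rep d x) (fd (base_rep d) x u) (fd (base_rep d) x v)"
  by (simp add: G_def differential_\<pi>[OF assms] comp2_def Let_def base_rep_img[OF assms])

lemma G_Z: assumes x: "x \<in> X" shows "G x (Z x) v = 0"
proof -
  obtain d where d: "d \<in> atlas N" "x \<in> base_dom d" using base_chart_exists[OF x] by blast
  show ?thesis
    unfolding G_eq[OF d] base_rep_Z[OF d]
    by (rule bilinear_lzero[OF metric_base[OF d(1) base_rep_img(1)[OF d]]])
qed

text \<open>With \<open>P\<close> the projection in charts, \<open>G\<close> is the base metric at \<open>P y\<close> applied to derivatives of \<open>P\<close>. Along \<open>Z\<close>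
  the base point does not move, and differentiating \<open>D P (Z) = 0\<close> shows that the change of \<open>D P (u)\<close>
  along \<open>Z\<close> is compensated by the term with the derivative of \<open>Z\<close>.\<close>

lemma G_lie:
  assumes x: "x \<in> X"
  shows "(\<lambda>y. G y u v) differentiable (at x)"
    and "fd (\<lambda>y. G y u v) x (Z x) + G x (fd Z x u) v + G x u (fd Z x v) = 0"
proof -
  obtain d where d: "d \<in> atlas N" and xd: "x \<in> base_dom d" using base_chart_exists[OF x] by blast
  let ?P = "base_rep d" and ?H = "comp2 N d g"
  note o = base_dom_open[OF d]
  have ddP: "((\<lambda>y. fd ?P y u) has_derivative fd (\<lambda>y. fd ?P y u) x) (at x)" for u
    by (rule has_derivative_fd[OF smooth_on_differentiable[OF smooth_on_fd[OF base_rep_smooth[OF d]] xd]])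
  have dH: "((\<lambda>y. ?H (?P y) a b) has_derivative (\<lambda>w. fd (\<lambda>z. ?H z a b) (?P x) (fd ?P x w))) (at x)" for a b
    by (rule has_derivative_compose[OF d_base_rep[OF d xd] has_derivative_fd[OF
          smooth_on_differentiable[OF metric_base_smooth[OF d] base_rep_img(1)[OF d xd]]]])
  have "((\<lambda>y. ?H (?P y) (fd ?P y u) (fd ?P y v)) has_derivative
     (\<lambda>w. fd (\<lambda>y. ?H (?P y) (fd ?P x u) (fd ?P x v)) x w
        + ?H (?P x) (fd (\<lambda>y. fd ?P y u) x w) (fd ?P x v)
        + ?H (?P x) (fd ?P x u) (fd (\<lambda>y. fd ?P y v) x w))) (at x)"
    by (rule bilinear_family_product_rule[OF o xd metric_base[OF d base_rep_img(1)[OF d]]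
          differentiableI[OF dH] ddP ddP])
  then have G': "((\<lambda>y. G y u v) has_derivative
     (\<lambda>w. fd (\<lambda>y. ?H (?P y) (fd ?P x u) (fd ?P x v)) x w
        + ?H (?P x) (fd (\<lambda>y. fd ?P y u) x w) (fd ?P x v)
        + ?H (?P x) (fd ?P x u) (fd (\<lambda>y. fd ?P y v) x w))) (at x)"
    by (rule has_derivative_transform_within_open[OF _ o xd]) (rule G_eq[OF d, symmetric])
  show "(\<lambda>y. G y u v) differentiable (at x)" by (rule differentiableI[OF G'])
  have Z1: "fd (\<lambda>y. ?H (?P y) a b) x (Z x) = 0" for a b
    using fd_eq[OF dH, of a b] base_rep_Z[OF d xd]
      linear_0[OF linear_fd[OF smooth_on_differentiable[OF metric_base_smooth[OF d] base_rep_img(1)[OF d xd]]]]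
    by simp
  have Z2: "fd (\<lambda>y. fd ?P y u) x (Z x) = - fd ?P x (fd Z x u)" for u
  proof -
    have "((\<lambda>y. fd ?P y (Z y)) has_derivative
        (\<lambda>u. fd (\<lambda>y. fd ?P y (Z x)) x u + fd ?P x (fd Z x u))) (at x)"
      by (rule linear_family_product_rule[OF o xd has_derivative_linear[OF d_base_rep[OF d]]
            differentiableI[OF ddP] dZ[OF x]])
    moreover have "((\<lambda>y. fd ?P y (Z y)) has_derivative (\<lambda>v. 0)) (at x)"
      by (rule has_derivative_transform_within_open[OF has_derivative_const o xd]) (simp add: base_rep_Z[OF d])
    ultimately have "fd (\<lambda>y. fd ?P y (Z x)) x u + fd ?P x (fd Z x u) = 0"
      by (rule has_derivative_unique[THEN fun_cong])
    moreover have "fd (\<lambda>y. fd ?P y u) x (Z x) = fd (\<lambda>y. fd ?P y (Z x)) x u"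
      by (rule symmetric_second_derivative[OF base_rep_smooth[OF d] o xd])
    ultimately show ?thesis by (simp add: eq_neg_iff_add_eq_0)
  qed
  note bil = metric_base[OF d base_rep_img(1)[OF d xd]]
  show "fd (\<lambda>y. G y u v) x (Z x) + G x (fd Z x u) v + G x u (fd Z x v) = 0"
    unfolding fd_eq[OF G'] Z1 Z2 G_eq[OF d xd]
    by (simp add: bilinear_lneg[OF bil] bilinear_rneg[OF bil])
qed

end

section \<open>Background metrics of Kerr type in a chart\<close>

locale kerr_metric_chart = kerr_bundle_chart N J g S act \<pi> \<theta> c
  for N :: "('n, 'en::euclidean_space) mfd" and J :: "'n \<Rightarrow> 'n tvec \<Rightarrow> 'n tvec"
    and g :: "'n \<Rightarrow> 'n tvec \<Rightarrow> 'n tvec \<Rightarrow> real" and S :: "('s, 'es::euclidean_space) mfd"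
    and act :: "'s \<Rightarrow> real \<Rightarrow> 's" and \<pi> :: "'s \<Rightarrow> 'n" and \<theta> :: "'s \<Rightarrow> 's tvec \<Rightarrow> real"
    and c :: "('s, 'es) chart" +
  fixes I :: "real set" and \<sigma> :: "'s \<times> real \<Rightarrow> real" and B :: real
    and \<eta> :: "'s \<times> real \<Rightarrow> ('s \<times> real) tvec \<Rightarrow> ('s \<times> real) tvec \<Rightarrow> real"
  assumes I: "open I" and metric: "kerr_background_metric N g S act \<pi> \<theta> I \<sigma> B \<eta>"
begin

abbreviation M :: "('s \<times> real, 'es \<times> real) mfd" where "M \<equiv> kerr_mfd S I"
abbreviation cM :: "('s \<times> real, 'es \<times> real) chart" where "cM \<equiv> line_chart I c"
abbreviation Y :: "('es \<times> real) set" where "Y \<equiv> X \<times> I"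

lemma M: "smooth_atlas M" and cM: "cM \<in> atlas M" and points_M: "points M = points S \<times> I"
  using smooth_atlas_prod_line[OF S I] c by (simp_all add: kerr_mfd_def atlas_prod_line points_prod_line)

lemma Y_img: "chart_img cM = Y" by (rule chart_img_line_chart)

lemma Y_open: "open Y" using chart_open[OF M cM] by (simp add: Y_img)

lemma inv_cM: "x \<in> X \<Longrightarrow> t \<in> I \<Longrightarrow> chart_inv cM (x, t) = (pt x, t)"
  by (rule chart_inv_line_chart[OF S c])

lemma pt_cM: "x \<in> X \<Longrightarrow> t \<in> I \<Longrightarrow> (pt x, t) \<in> fst cM"
  by (simp add: pt_in)

subsection \<open>Fields and forms in product coordinates\<close>

lemma p_field_coord:
  assumes "x \<in> X" "t \<in> I" shows "p_field S I (pt x, t) = coord_vec M cM (pt x, t) (0, 1)"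
proof -
  have "velocity M (\<lambda>r. (pt x, r)) t = coord_vec M cM (pt x, t) (0, 1)"
    by (rule velocity_coord_vec[OF M cM I assms(2)])
      (auto simp: pt_in[OF assms(1)] intro!: derivative_eq_intros)
  then show ?thesis by (simp add: p_field_def)
qed

lemma q_field_coord:
  assumes x: "x \<in> X" "t \<in> I" shows "q_field S act I (pt x, t) = coord_vec M cM (pt x, t) (Z x, 0)"
proof -
  have "velocity M (\<lambda>r. (act (pt x) r, t)) 0 = coord_vec M cM (act (pt x) 0, t) (Z x, 0)"
  proof (rule velocity_coord_vec[OF M cM orbit_open[OF flow_dom_open, of x]])
    have "((\<lambda>r. (flow (x, r), t)) has_derivative (\<lambda>r. (r *\<^sub>R Z x, 0))) (at 0)"
      by (intro has_derivative_Pair orbit_derivative x has_derivative_const)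
    then show "((\<lambda>r. snd cM (act (pt x) r, t)) has_derivative (\<lambda>r. r *\<^sub>R (Z x, 0))) (at 0)"
      by (simp add: flow_eq[OF x(1)])
  qed (use flow_dom_0[OF x(1)] x(2) in \<open>simp_all add: flow_dom_iff[OF x(1)]\<close>)
  then show ?thesis by (simp add: q_field_def act_0[OF pt_points[OF x(1)]])
qed

lemma differential_fst:
  assumes x: "x \<in> X" "t \<in> I"
  shows "differential S fst (pt x, t) (coord_vec M cM (pt x, t) a) = coord_vec S c (pt x) (fst a)"
proof -
  have "differential S fst (pt x, t) (coord_vec M cM (pt x, t) a)
      = coord_vec S c (fst (pt x, t)) (fd fst (snd cM (pt x, t)) a)"
    by (rule differential_coord_vec(2)[OF M S cM pt_cM[OF x] c Y_open])
      (use x in \<open>auto simp: chart_pt Y_img inv_cM pt_in intro!: smooth_on_bounded_linear bounded_linear_fst\<close>)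
  moreover have "fd fst (x, t) = fst"
    by (rule fd_eq) (rule bounded_linear_imp_has_derivative[OF bounded_linear_fst])
  ultimately show ?thesis by (simp add: chart_pt[OF x(1)])
qed

lemma differential_slice:
  assumes x: "x \<in> X" "t \<in> I"
  shows "differential M (\<lambda>s. (s, t)) (pt x) (coord_vec S c (pt x) a) = coord_vec M cM (pt x, t) (a, 0)"
proof -
  have "smooth_on X (\<lambda>x. (x, t))"
    using smooth_on_add[OF smooth_on_bounded_linear[OF bounded_linear_Pair[OF bounded_linear_ident bounded_linear_zero]]
        smooth_on_const[of X "(0, t)"] X_open] by simp
  then have "differential M (\<lambda>s. (s, t)) (pt x) (coord_vec S c (pt x) a)
      = coord_vec M cM (pt x, t) (fd (\<lambda>x. (x, t)) (snd c (pt x)) a)"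
    by (intro differential_coord_vec(2)[OF S M c pt_in[OF x(1)] cM X_open])
      (use x in \<open>auto simp: chart_pt pt_in\<close>)
  moreover have "fd (\<lambda>x. (x, t)) x = (\<lambda>a. (a, 0))"
    by (rule fd_eq) (auto intro!: derivative_eq_intros)
  ultimately show ?thesis by (simp add: chart_pt[OF x(1)])
qed

lemma differential_base:
  assumes x: "x \<in> X" "t \<in> I"
  shows "differential N (\<pi> \<circ> fst) (pt x, t) (coord_vec M cM (pt x, t) a)
     = differential N \<pi> (pt x) (coord_vec S c (pt x) (fst a))"
proof -
  have "differential N (\<pi> \<circ> fst) (pt x, t) v = differential N \<pi> (pt x) (differential S fst (pt x, t) v)" for v
    using smooth_near_\<pi>[OF x(1)] by (auto simp: differential_def fun_eq_iff o_assoc)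
  then show ?thesis by (simp add: differential_fst[OF x])
qed

lemma lifted_form_coord:
  assumes x: "x \<in> X" "t \<in> I"
  shows "lifted_form S \<theta> (pt x, t) (coord_vec M cM (pt x, t) a) = th x (fst a)"
  by (simp add: lifted_form_def differential_fst[OF x] comp1_def Let_def)

text \<open>The three conditions on \<open>\<beta>\<close> determine it on the splitting of a vector into its horizontal part,
  a multiple of the fundamental field and a multiple of the coordinate field.\<close>

lemma p_dual_coord:
  assumes \<beta>: "is_p_dual S act \<theta> I \<beta>" and x: "x \<in> X" "t \<in> I"
  shows "\<beta> (pt x, t) (coord_vec M cM (pt x, t) a) = snd a"
proof -
  define b where "b = comp1 M cM \<beta> (x, t)"
  have b: "b u = \<beta> (pt x, t) (coord_vec M cM (pt x, t) u)" for u
    by (simp add: b_def comp1_def Let_def inv_cM[OF x])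
  have "(x, t) \<in> chart_img cM" using x by (simp add: Y_img)
  then have lin: "linear b"
    using \<beta> cM unfolding is_p_dual_def one_form_def b_def by blast
  have "\<beta> (pt x, t) (p_field S I (pt x, t)) = 1" "\<beta> (pt x, t) (q_field S act I (pt x, t)) = 0"
    using \<beta> pt_points[OF x(1)] x(2) unfolding is_p_dual_def by blast+
  then have bp: "b (0, 1) = 1" and bq: "b (Z x, 0) = 0"
    unfolding b p_field_coord[OF x] q_field_coord[OF x] .
  have hor: "b (w, 0) = 0" if "th x w = 0" for w
  proof -
    have "\<theta> (pt x) (coord_vec S c (pt x) w) = 0" using that by (simp add: comp1_def Let_def)
    then have "\<beta> (pt x, t) (differential M (\<lambda>s. (s, t)) (pt x) (coord_vec S c (pt x) w)) = 0"
      using \<beta> pt_points[OF x(1)] x(2) coord_vec_tangent[OF S c pt_in[OF x(1)], of w]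
      unfolding is_p_dual_def by blast
    then show ?thesis by (simp add: b differential_slice[OF x])
  qed
  define w where "w = fst a - th x (fst a) *\<^sub>R Z x"
  have "th x w = 0"
    by (simp add: w_def linear_diff[OF th_linear[OF x(1)]] linear_scale[OF th_linear[OF x(1)]] th_Z[OF x(1)])
  have "a = (w, 0) + th x (fst a) *\<^sub>R (Z x, 0) + snd a *\<^sub>R (0, 1)"
    by (cases a) (simp add: w_def)
  then have "b a = b ((w, 0) + th x (fst a) *\<^sub>R (Z x, 0) + snd a *\<^sub>R (0, 1))" by (rule arg_cong)
  also have "\<dots> = snd a"
    using hor[OF \<open>th x w = 0\<close>] bp bq by (simp only: linear_add[OF lin] linear_scale[OF lin]) simp
  finally show ?thesis by (simp add: b)
qed

subsection \<open>Parallel field of the background metric\<close>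

abbreviation h :: "'es \<times> real \<Rightarrow> 'es \<times> real \<Rightarrow> 'es \<times> real \<Rightarrow> real" where "h \<equiv> comp2 M cM \<eta>"

abbreviation sg :: "'es \<times> real \<Rightarrow> real" where "sg \<equiv> \<sigma> \<circ> chart_inv cM"

text \<open>The components of \<open>q - B p\<close>, the field that turns out to be parallel.\<close>

definition T :: "'es \<times> real \<Rightarrow> 'es \<times> real" where "T y = (Z (fst y), - B)"

lemma B: "B \<noteq> 0" and \<sigma>_smooth: "smooth_fun M \<sigma>"
  and T_\<sigma>: "p \<in> points M \<Longrightarrow> q_field S act I p \<sigma> - B * p_field S I p \<sigma> = 0"
  and lorentzian: "lorentzian_metric M \<eta>" and einstein: "einstein M \<eta>"
  using metric unfolding kerr_background_metric_def Let_def by blast+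

lemma h_coord:
  assumes x: "x \<in> X" "t \<in> I"
  shows "h (x, t) a b = sg (x, t) * G x (fst a) (fst b) +
    (th x (fst a) * snd b + snd a * th x (fst b) + B * (th x (fst a) * th x (fst b))) / 2"
proof -
  obtain \<beta> where \<beta>: "is_p_dual S act \<theta> I \<beta>"
    and \<eta>: "\<forall>p\<in>points M. \<forall>v\<in>tangent_space M p. \<forall>w\<in>tangent_space M p.
          \<eta> p v w = \<sigma> p * g ((\<pi> \<circ> fst) p) (differential N (\<pi> \<circ> fst) p v) (differential N (\<pi> \<circ> fst) p w)
            + sym_prod (lifted_form S \<theta> p) (\<lambda>z. \<beta> p z + B / 2 * lifted_form S \<theta> p z) v w"
    using metric unfolding kerr_background_metric_def Let_def by blast
  have p: "(pt x, t) \<in> points M" using pt_points[OF x(1)] x(2) by (simp add: points_M)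
  have tan: "coord_vec M cM (pt x, t) u \<in> tangent_space M (pt x, t)" for u
    by (rule coord_vec_tangent[OF M cM pt_cM[OF x]])
  have "h (x, t) a b = \<eta> (pt x, t) (coord_vec M cM (pt x, t) a) (coord_vec M cM (pt x, t) b)"
    by (simp add: comp2_def Let_def inv_cM[OF x])
  also have "\<dots> = sg (x, t) * G x (fst a) (fst b) +
     sym_prod (lifted_form S \<theta> (pt x, t)) (\<lambda>z. \<beta> (pt x, t) z + B / 2 * lifted_form S \<theta> (pt x, t) z)
        (coord_vec M cM (pt x, t) a) (coord_vec M cM (pt x, t) b)"
    using \<eta> p tan by (simp add: inv_cM[OF x] differential_base[OF x] G_def)
  finally show ?thesis
    by (simp add: sym_prod_def lifted_form_coord[OF x] p_dual_coord[OF \<beta> x] field_simps)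
qed

lemma sg_derivative:
  assumes x: "x \<in> X" "t \<in> I"
  shows "sg differentiable (at (x, t))" and "fd sg (x, t) (Z x, - B) = 0"
proof -
  have p: "(pt x, t) \<in> points M" using pt_points[OF x(1)] x(2) by (simp add: points_M)
  have near: "smooth_near M (pt x, t) \<sigma>" by (rule smooth_fun_near[OF M \<sigma>_smooth p])
  have d: "sg differentiable (at (x, t))"
    using smooth_near_differentiable[OF M near cM pt_cM[OF x]] by (simp add: chart_pt[OF x(1)])
  then show "sg differentiable (at (x, t))" .
  have "coord_vec M cM (pt x, t) a \<sigma> = fd sg (x, t) a" for a
    by (simp add: coord_vec_def near chart_pt[OF x(1)])
  then have "fd sg (x, t) (Z x, 0) - B * fd sg (x, t) (0, 1) = 0"
    using T_\<sigma>[OF p] by (simp add: p_field_coord[OF x] q_field_coord[OF x])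
  moreover have "(Z x, - B) = (Z x, 0) - B *\<^sub>R (0, 1)" by simp
  ultimately show "fd sg (x, t) (Z x, - B) = 0"
    using linear_diff[OF linear_fd[OF d]] linear_scale[OF linear_fd[OF d]] by (metis real_scaleR_def)
qed

text \<open>The coefficient \<open>B / 2\<close> in the metric is the one for which the contributions of \<open>\<theta>\<close> cancel.\<close>

lemma h_T:
  assumes "y \<in> Y" shows "h y (T y) w = snd w / 2"
proof -
  obtain x t where y: "y = (x, t)" "x \<in> X" "t \<in> I" using assms by auto
  show ?thesis unfolding y(1) by (simp add: h_coord[OF y(2,3)] T_def G_Z[OF y(2)] th_Z[OF y(2)])
qed

lemma T_smooth: "smooth_on Y T"
proof -
  have "smooth_on Y (\<lambda>y. Z (fst y))"
    by (rule smooth_on_compose[OF Z_smooth smooth_on_bounded_linear[OF bounded_linear_fst] Y_open]) auto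
  then show ?thesis
    unfolding T_def[abs_def] by (rule smooth_on_Pair[OF _ smooth_on_const Y_open])
qed

lemma fd_T:
  assumes x: "x \<in> X" "t \<in> I" shows "fd T (x, t) v = (fd Z x (fst v), 0)"
proof -
  have "((\<lambda>y. Z (fst y)) has_derivative (\<lambda>v. fd Z x (fst v))) (at (x, t))"
    by (rule has_derivative_compose[OF bounded_linear_imp_has_derivative[OF bounded_linear_fst]])
      (simp add: dZ[OF x(1)])
  then have "(T has_derivative (\<lambda>v. (fd Z x (fst v), 0))) (at (x, t))"
    unfolding T_def[abs_def] by (intro has_derivative_Pair has_derivative_const)
  then show ?thesis by (simp add: fd_eq)
qed

text \<open>The Lie derivative of each of the three ingredients \<open>sg\<close>, \<open>G\<close> and \<open>th\<close> along \<open>T\<close> is zero, and the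
  form \<open>du\<close> is invariant because the last component of \<open>T\<close> is constant.\<close>

lemma h_killing:
  assumes "y \<in> Y"
  shows "fd (\<lambda>z. h z v w) y (T y) + h y (fd T y v) w + h y v (fd T y w) = 0"
proof -
  obtain x t where y: "y = (x, t)" and x: "x \<in> X" "t \<in> I" using assms by auto
  have lift: "((\<lambda>z. f (fst z)) has_derivative (\<lambda>a. fd f x (fst a))) (at (x, t))"
    if "f differentiable (at x)" for f :: "'es \<Rightarrow> real"
    by (rule has_derivative_compose[OF bounded_linear_imp_has_derivative[OF bounded_linear_fst]])
      (simp add: has_derivative_fd[OF that])
  note dG = lift[OF G_lie(1)[OF x(1), of "fst v" "fst w"]]
  note d1 = lift[OF dth[OF x(1), of "fst v"]] and d2 = lift[OF dth[OF x(1), of "fst w"]]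
  define e1 where "e1 = fd (\<lambda>x. th x (fst v)) x (Z x)"
  define e2 where "e2 = fd (\<lambda>x. th x (fst w)) x (Z x)"
  have "((\<lambda>z. sg z * G (fst z) (fst v) (fst w) + (th (fst z) (fst v) * snd w + snd v * th (fst z) (fst w)
        + B * (th (fst z) (fst v) * th (fst z) (fst w))) / 2) has_derivative
     (\<lambda>a. (sg (x, t) * fd (\<lambda>x. G x (fst v) (fst w)) x (fst a) + fd sg (x, t) a * G x (fst v) (fst w)) +
        (fd (\<lambda>x. th x (fst v)) x (fst a) * snd w + snd v * fd (\<lambda>x. th x (fst w)) x (fst a)
        + B * (th x (fst v) * fd (\<lambda>x. th x (fst w)) x (fst a)
            + fd (\<lambda>x. th x (fst v)) x (fst a) * th x (fst w))) / 2)) (at (x, t))"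
    using has_derivative_add[OF has_derivative_mult[OF has_derivative_fd[OF sg_derivative(1)[OF x]] dG]
        bounded_linear.has_derivative[OF bounded_linear_divide[of 2] has_derivative_add[OF
          has_derivative_add[OF has_derivative_mult_left[OF d1] has_derivative_mult_right[OF d2]]
          has_derivative_mult_right[OF has_derivative_mult[OF d1 d2]]]]]
    by (simp only: fst_conv)
  then have "((\<lambda>z. h z v w) has_derivative
     (\<lambda>a. (sg (x, t) * fd (\<lambda>x. G x (fst v) (fst w)) x (fst a) + fd sg (x, t) a * G x (fst v) (fst w)) +
        (fd (\<lambda>x. th x (fst v)) x (fst a) * snd w + snd v * fd (\<lambda>x. th x (fst w)) x (fst a)
        + B * (th x (fst v) * fd (\<lambda>x. th x (fst w)) x (fst a)
            + fd (\<lambda>x. th x (fst v)) x (fst a) * th x (fst w))) / 2)) (at (x, t))"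
    by (rule has_derivative_transform_within_open[OF _ Y_open]) (use x in \<open>auto simp: h_coord\<close>)
  from fd_eq[OF this]
  have 1: "fd (\<lambda>z. h z v w) (x, t) (T (x, t)) = sg (x, t) * fd (\<lambda>x. G x (fst v) (fst w)) x (Z x)
      + (e1 * snd w + snd v * e2 + B * (th x (fst v) * e2 + e1 * th x (fst w))) / 2"
    by (simp add: T_def sg_derivative(2)[OF x] e1_def e2_def)
  have 2: "th x (fd Z x (fst v)) = - e1" "th x (fd Z x (fst w)) = - e2"
    using th_lie[OF x(1), of "fst v"] th_lie[OF x(1), of "fst w"] by (simp_all add: e1_def e2_def)
  have 3: "fd (\<lambda>x. G x (fst v) (fst w)) x (Z x)
      = - G x (fd Z x (fst v)) (fst w) - G x (fst v) (fd Z x (fst w))"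
    using G_lie(2)[OF x(1), of "fst v" "fst w"] by simp
  show ?thesis
    unfolding y 1 3 fd_T[OF x] h_coord[OF x] fst_conv snd_conv 2 by (simp add: field_simps)
qed

lemma h_tensor: "y \<in> Y \<Longrightarrow> bilinear (h y)" "y \<in> Y \<Longrightarrow> h y u v = h y v u"
    "smooth_on Y (\<lambda>y. h y u v)"
  using lorentzian cM unfolding lorentzian_metric_def sym_tensor_def Y_img[symmetric] by blast+

text \<open>The pseudo-orthonormal frame provided by the Lorentzian signature may come from a different chart at
  each vector; its components in the given chart are the image of the standard basis under an
  injective, hence bijective, linear map.\<close>

lemma h_nondegenerate:
  assumes "y \<in> Y" and null: "\<And>w. h y u w = 0" shows "u = 0"
proof -
  obtain x t where y: "y = (x, t)" and x: "x \<in> X" "t \<in> I" using assms by auto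
  have p: "(pt x, t) \<in> points M" using pt_points[OF x(1)] x(2) by (simp add: points_M)
  obtain \<epsilon> :: real where \<epsilon>: "\<epsilon> \<in> {1, -1}" and frame: "\<forall>p\<in>points M.
      \<exists>b::'es \<times> real \<Rightarrow> ('s \<times> real) tvec. \<exists>k\<in>Basis. b ` Basis \<subseteq> tangent_space M p \<and>
        (\<forall>i\<in>Basis. \<forall>j\<in>Basis. \<eta> p (b i) (b j) = (if i \<noteq> j then 0 else if i = k then - \<epsilon> else \<epsilon>))"
    using lorentzian unfolding lorentzian_metric_def by blast
  obtain b k where b: "b ` (Basis :: ('es \<times> real) set) \<subseteq> tangent_space M (pt x, t)"
    and on: "\<forall>i\<in>Basis. \<forall>j\<in>Basis. \<eta> (pt x, t) (b i) (b j) = (if i \<noteq> j then 0 else if i = k then - \<epsilon> else \<epsilon>)"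
    using bspec[OF frame p] by blast
  have "\<forall>i\<in>Basis. \<exists>e. b i = coord_vec M cM (pt x, t) e"
  proof
    fix i :: "'es \<times> real" assume "i \<in> Basis"
    then have "b i \<in> tangent_space M (pt x, t)" using b by blast
    then show "\<exists>e. b i = coord_vec M cM (pt x, t) e"
      by (rule tangent_space_chart[OF M cM pt_cM[OF x]]) (rule exI)
  qed
  from bchoice[OF this] obtain e
    where e: "\<And>i. i \<in> Basis \<Longrightarrow> b i = coord_vec M cM (pt x, t) (e i)" by blast
  have he: "h y (e i) (e j) = (if i \<noteq> j then 0 else if i = k then - \<epsilon> else \<epsilon>)"
    if "i \<in> Basis" "j \<in> Basis" for i j
    using on that by (simp add: y comp2_def Let_def inv_cM[OF x] e)
  have l1: "linear (\<lambda>u. h y u w)" and l2: "linear (h y u)" for u w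
    using h_tensor(1)[OF assms(1)] unfolding bilinear_def by blast+
  have \<epsilon>0: "\<epsilon> \<noteq> 0" using \<epsilon> by auto
  define L where "L = (\<lambda>z::'es \<times> real. \<Sum>i\<in>Basis. (z \<bullet> i) *\<^sub>R e i)"
  have L: "linear L"
    by (intro linearI) (simp_all add: L_def inner_add_left scaleR_add_left sum.distrib scaleR_sum_right)
  have comp: "h y (L z) (e j) = (z \<bullet> j) * h y (e j) (e j)" if j: "j \<in> Basis" for z j
  proof -
    have "h y (L z) (e j) = (\<Sum>i\<in>Basis. if i = j then (z \<bullet> j) * h y (e j) (e j) else 0)"
      unfolding L_def linear_sum[OF l1] linear_scale[OF l1]
      by (intro sum.cong refl) (simp add: he j)
    then show ?thesis using j by simp
  qed
  have "inj L"
  proof (subst linear_injective_0[OF L], intro allI impI)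
    fix z assume "L z = 0"
    then have "z \<bullet> j = 0" if "j \<in> Basis" for j
      using comp[OF that, of z] he[OF that that] \<epsilon>0 linear_0[OF l1] by (simp split: if_splits)
    then show "z = 0" by - (rule euclidean_eqI, simp)
  qed
  then have "surj L" by (rule linear_injective_imp_surjective[OF L]) simp
  then obtain z where z: "u = L z" by (rule surjE)
  have "z \<bullet> j = 0" if "j \<in> Basis" for j
    using comp[OF that, of z] null[of "e j"] he[OF that that] \<epsilon>0 by (simp add: z split: if_splits)
  then have "z = 0" by - (rule euclidean_eqI, simp)
  then show ?thesis using z linear_0[OF L] by simp
qed

lemma local_metric_h: "local_metric Y h"
  by (rule local_metric.intro[OF Y_open h_tensor h_nondegenerate])

theorem riemann_eq_0_in_chart:
  assumes dim: "DIM('es \<times> real) = 4" and y: "y \<in> Y"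
  shows "riemann h y u v w = 0"
proof -
  obtain \<Lambda> where \<Lambda>: "\<And>v w. ricci h y v w = \<Lambda> * h y v w"
    using einstein cM y unfolding einstein_def Y_img[symmetric] by blast
  show ?thesis
    by (rule local_metric.flat_if_einstein_with_closed_killing_field[OF local_metric_h y dim T_smooth
          h_T _ h_killing \<Lambda>]) (simp_all add: T_def B)
qed

end

theorem proposition2p9:
  fixes N :: "('n, 'en::euclidean_space) mfd"
    and J :: "'n \<Rightarrow> 'n tvec \<Rightarrow> 'n tvec"
    and g :: "'n \<Rightarrow> 'n tvec \<Rightarrow> 'n tvec \<Rightarrow> real"
    and S :: "('s, 'es::euclidean_space) mfd"
    and act :: "'s \<Rightarrow> real \<Rightarrow> 's"
    and \<pi> :: "'s \<Rightarrow> 'n"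
    and \<theta> :: "'s \<Rightarrow> 's tvec \<Rightarrow> real"
    and I :: "real set"
    and \<sigma> :: "'s \<times> real \<Rightarrow> real"
    and B :: real
    and \<eta> :: "'s \<times> real \<Rightarrow> ('s \<times> real) tvec \<Rightarrow> ('s \<times> real) tvec \<Rightarrow> real"
  assumes "kerr_structure N J g S act \<pi> \<theta>"
    and "kerr_domain S I"
    and "mfd_dim (kerr_mfd S I) = 4"
    and "kerr_background_metric N g S act \<pi> \<theta> I \<sigma> B \<eta>"
  shows "vanishing_curvature (kerr_mfd S I) \<eta>"
  unfolding vanishing_curvature_def
proof (intro ballI allI)
  fix c' y u v w
  assume "c' \<in> atlas (kerr_mfd S I)" and y: "y \<in> chart_img c'"
  then obtain c where c': "c' = line_chart I c" and c: "c \<in> atlas S"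
    by (auto simp: kerr_mfd_def atlas_prod_line)
  have "open I" using assms(2) unfolding kerr_domain_def by auto
  then interpret kerr_metric_chart N J g S act \<pi> \<theta> c I \<sigma> B \<eta>
    using assms c by unfold_locales
  show "riemann (comp2 (kerr_mfd S I) c' \<eta>) y u v w = 0"
    unfolding c' by (rule riemann_eq_0_in_chart) (use assms(3) y c' Y_img in \<open>simp_all add: mfd_dim_def\<close>)
qed

end
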